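(* The set of paths $(p,q)\in\mathcal{C}$ such that $\mathcal{F}$ has an optimum with respect to $\Delta$ at $\Delta=0$ (i.e. $\Delta=0$ minimizes $\mathcal{F}(\cdot,p,q)$ over $\mathcal{M}_0(D)$) contains an open neighborhood of every geodesic $q(t)$ in the $C^2([0,1],L^2([0,1]))$ topology.
   Context: $D=[0,1]^2$ with points $(t,x)$ (time, space); dots are time derivatives. For $q\in L^2([0,1])$ put $\eta(q)(x)=\exp(\int_0^xq(u)\,du)$, $\varphi(q)(x)=\int_0^x\eta(q)(y)\,dy$ (argument $q$ often omitted). $Q=\{q\in L^2([0,1]):\int_0^1q\,dx=0,\ \int_0^1\eta(q)\,dx=1\}$, with Riemannian metric $G(q)(X,X)=\int_0^1X^2/\eta(q)\,dx$; "geodesic" means geodesic of $(Q,G)$ on the time interval $[0,1]$. Write $\langle f,g\rangle_\eta=\int_0^1fg\,\eta\,dx$, $H_2=\begin{bmatrix}1&1/2\\1/2&1/3\end{bmatrix}$, $\pi_q^*(p)=p-\begin{bmatrix}1&\varphi\end{bmatrix}H_2^{-1}\begin{bmatrix}\langle p,1\rangle_\eta\\ \langle p,\varphi\rangle_\eta\end{bmatrix}$. $T_q^*Q$ is identified with the range of $\pi_q^*$, i.e. $\{p\in L^2:\langle p,1\rangle_\eta=\langle p,\varphi\rangle_\eta=0\}$, with norm $\|p\|_q^2=\int_0^1\eta\,p^2dx$; $X^\flat=X/\eta$ for $X\in T_qQ$. Given $q_0\in Q$, $p_0\in T_{q_0}^*Q$, $\mathcal{C}^0$ is the set of curves $(p(t),q(t))\in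 T^*Q$, $t\in[0,1]$, with $q\in H^2([0,1],L^2([0,1]))$, $\dot q=\eta(q)p$, $q(0)=q_0$, $p(0)=p_0$; $\mathcal{C}^{0,1}$ is the subset of those with in addition $q(1)=q_1$, $p(1)=p_1$ for given $q_1\in Q$, $p_1\in T_{q_1}^*Q$; $\mathcal{C}$ stands for either. $\frac{D}{Dt}\dot q$ is the covariant derivative of $\dot q$ along $q$ for $(Q,G)$; explicitly, with $\mathcal{U}(f,q)(x)=\frac12\int_x^1\eta(q)f\,dy$ and $b=\frac32\int_0^1(\int_0^xp\circ\varphi^{-1}dy)^2dx$, $$\Big(\tfrac{D}{Dt}\dot q\Big)^\flat=\dot p+\mathcal{U}(p^2,q)-\begin{bmatrix}1&\varphi\end{bmatrix}H_2^{-1}\begin{bmatrix}0\\ b\end{bmatrix}-(\mathrm{id}-\pi_q^* )(\mathcal{U}(p^2,q)).$$ For a measure $\Delta=\Delta_t\,dt$ on $D$, $\mathcal{U}(\Delta,q)(t,x)=\frac12\int_x^1\eta(q(t))\,d\Delta_t$. Fisher-Rao functional: $r(x,y)=\frac14\frac{y^2}{x}$ if $x>0$, $r(0,0)=0$, $r=+\infty$ otherwise; for finite signed Radon measures $\mu,\nu$ on $D$ and $f\in C^0(D,(0,\infty))$, $\mathrm{FR}_f(\mu,\nu)=\int_Dr(\frac{d\mu}{d\lambda},\frac{d\nu}{d\lambda})f\,d\lambda$ for any positive $\lambda$ dominating $\mu,\nu$. $\mathcal{M}_0(D)$ is the set of positive finite Radon measures $\Delta$ on $D$ with $\Delta_{t=0}=0$.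 The conditions $\Delta_{t=0}=0$ and $\partial_t\Delta=\delta$ are understood weakly: $\int_D\partial_tf\,d\Delta+\int_Df\,d\delta=0$ for all continuous $f$ on $D$ that are $C^1$ in $t$ with $f(1,x)=0$ for all $x$. The functional is $$\mathcal{F}(\Delta,p,q)=\mathrm{FR}_\eta(\Delta,\partial_t\Delta)+\int_0^1\Big\|\Big(\tfrac{D}{Dt}\dot q\Big)^\flat+\pi_q^*(\mathcal{U}(\Delta,q))\Big\|_q^2dt+P(p(1),q(1)),$$ with value $+\infty$ if $\partial_t\Delta$ is not a finite Radon measure; $P$ is a real-valued functional on $T^*Q$. *)

theory Defs
  imports "HOL-Analysis.Analysis"
begin

section \<open>Square-integrable functions on the unit interval and curves of them\<close>

text \<open>
  Elements of $L^2([0,1])$ are represented by functions; every notion below depends only on the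
  values in $[0,1]$ and on the class modulo null sets, and equality in $L^2$ is spelled out as
  equality almost everywhere. A curve in $L^2$ is a function of time \<open>t\<close> and then of space \<open>x\<close>;
  only times \<open>t\<close> in $[0,1]$ matter.
\<close>

abbreviation unit_leb :: "real measure" where
  "unit_leb \<equiv> lebesgue_on {0..1}"

definition L2 :: "(real \<Rightarrow> real) set" where
  "L2 = {f. f \<in> borel_measurable unit_leb \<and> integrable unit_leb (\<lambda>x. (f x)\<^sup>2)}"

definition L2_inner :: "(real \<Rightarrow> real) \<Rightarrow> (real \<Rightarrow> real) \<Rightarrow> real" where
  "L2_inner f g = (LINT x|unit_leb. f x * g x)"

definition L2_norm :: "(real \<Rightarrow> real) \<Rightarrow> real" where
  "L2_norm f = sqrt (L2_inner f f)"

definition L2_eq :: "(real \<Rightarrow> real) \<Rightarrow> (real \<Rightarrow> real) \<Rightarrow> bool" where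
  "L2_eq f g \<longleftrightarrow> (AE x in unit_leb. f x = g x)"

text \<open>Strong (norm) derivative of a curve in $L^2$, one-sided at the end points.\<close>

definition has_L2_deriv :: "(real \<Rightarrow> real \<Rightarrow> real) \<Rightarrow> (real \<Rightarrow> real) \<Rightarrow> real \<Rightarrow> bool" where
  "has_L2_deriv u v t \<longleftrightarrow> (\<forall>s\<in>{0..1}. u s \<in> L2) \<and> v \<in> L2 \<and>
     ((\<lambda>s. L2_norm (\<lambda>x. (u s x - u t x) / (s - t) - v x)) \<longlongrightarrow> 0) (at t within {0..1})"

definition L2_deriv :: "(real \<Rightarrow> real \<Rightarrow> real) \<Rightarrow> real \<Rightarrow> real \<Rightarrow> real" where
  "L2_deriv u t = (SOME v. has_L2_deriv u v t)"

text \<open>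
  \<open>H1_deriv u g\<close> says that $u \in H^1([0,1],L^2)$ has derivative $g \in L^2([0,1],L^2)$, that is
  $u(t) = u(0) + \int_0^t g\,ds$ for all \<open>t\<close> (so \<open>u\<close> is the continuous representative). The Bochner
  integral is expressed by pairing with all $h \in L^2$; as $L^2$ is separable, weak measurability
  of \<open>g\<close> is strong measurability (Pettis).
\<close>

definition H1_deriv :: "(real \<Rightarrow> real \<Rightarrow> real) \<Rightarrow> (real \<Rightarrow> real \<Rightarrow> real) \<Rightarrow> bool" where
  "H1_deriv u g \<longleftrightarrow>
     (\<forall>t\<in>{0..1}. u t \<in> L2 \<and> g t \<in> L2) \<and>
     (\<forall>h\<in>L2. (\<lambda>t. L2_inner (g t) h) \<in> borel_measurable unit_leb) \<and>
     integrable unit_leb (\<lambda>t. (L2_norm (g t))\<^sup>2) \<and>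
     (\<forall>h\<in>L2. \<forall>t\<in>{0..1}.
        L2_inner (u t) h = L2_inner (u 0) h + (LINT s|lebesgue_on {0..t}. L2_inner (g s) h))"

definition H2_curve :: "(real \<Rightarrow> real \<Rightarrow> real) \<Rightarrow> bool" where
  "H2_curve q \<longleftrightarrow> (\<exists>v a. H1_deriv q v \<and> H1_deriv v a)"

definition L2_continuous :: "(real \<Rightarrow> real \<Rightarrow> real) \<Rightarrow> bool" where
  "L2_continuous u \<longleftrightarrow> (\<forall>t\<in>{0..1}. u t \<in> L2) \<and>
     (\<forall>t\<in>{0..1}. ((\<lambda>s. L2_norm (\<lambda>x. u s x - u t x)) \<longlongrightarrow> 0) (at t within {0..1}))"

definition C2_curve :: "(real \<Rightarrow> real \<Rightarrow> real) \<Rightarrow> bool" where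
  "C2_curve q \<longleftrightarrow>
     (\<forall>t\<in>{0..1}. has_L2_deriv q (L2_deriv q t) t) \<and>
     (\<forall>t\<in>{0..1}. has_L2_deriv (L2_deriv q) (L2_deriv (L2_deriv q) t) t) \<and>
     L2_continuous (L2_deriv (L2_deriv q))"

definition C2_norm :: "(real \<Rightarrow> real \<Rightarrow> real) \<Rightarrow> real" where
  "C2_norm u = (SUP t\<in>{0..1}. L2_norm (u t)) + (SUP t\<in>{0..1}. L2_norm (L2_deriv u t))
     + (SUP t\<in>{0..1}. L2_norm (L2_deriv (L2_deriv u) t))"


section \<open>The manifold \<open>Q\<close>, its cotangent spaces and its geodesics\<close>

definition eta :: "(real \<Rightarrow> real) \<Rightarrow> real \<Rightarrow> real" where
  "eta q x = exp (LINT u|lebesgue_on {0..x}. q u)"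

definition phi :: "(real \<Rightarrow> real) \<Rightarrow> real \<Rightarrow> real" where
  "phi q x = (LINT y|lebesgue_on {0..x}. eta q y)"

definition Q_mfd :: "(real \<Rightarrow> real) set" where
  "Q_mfd = {q \<in> L2. (LINT x|unit_leb. q x) = 0 \<and> (LINT x|unit_leb. eta q x) = 1}"

definition inner_eta :: "(real \<Rightarrow> real) \<Rightarrow> (real \<Rightarrow> real) \<Rightarrow> (real \<Rightarrow> real) \<Rightarrow> real" where
  "inner_eta q f g = (LINT x|unit_leb. f x * g x * eta q x)"

definition H2_mat :: "real^2^2" where
  "H2_mat = vector [vector [1, 1/2], vector [1/2, 1/3]]"

text \<open>The function $[1\ \varphi]\,H_2^{-1}\,v$.\<close>

definition H2_corr :: "(real \<Rightarrow> real) \<Rightarrow> real^2 \<Rightarrow> real \<Rightarrow> real" where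
  "H2_corr q v x = (vector [1, phi q x] :: real^2) \<bullet> (matrix_inv H2_mat *v v)"

definition pi_star :: "(real \<Rightarrow> real) \<Rightarrow> (real \<Rightarrow> real) \<Rightarrow> real \<Rightarrow> real" where
  "pi_star q p x = p x - H2_corr q (vector [inner_eta q p (\<lambda>_. 1), inner_eta q p (phi q)]) x"

definition cotangent :: "(real \<Rightarrow> real) \<Rightarrow> (real \<Rightarrow> real) set" where
  "cotangent q = {p \<in> L2. inner_eta q p (\<lambda>_. 1) = 0 \<and> inner_eta q p (phi q) = 0}"

definition norm_sq_at :: "(real \<Rightarrow> real) \<Rightarrow> (real \<Rightarrow> real) \<Rightarrow> real" where
  "norm_sq_at q p = (LINT x|unit_leb. eta q x * (p x)\<^sup>2)"

definition U_fun :: "(real \<Rightarrow> real) \<Rightarrow> (real \<Rightarrow> real) \<Rightarrow> real \<Rightarrow> real" where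
  "U_fun f q x = 1/2 * (LINT y|lebesgue_on {x..1}. eta q y * f y)"

definition b_coeff :: "(real \<Rightarrow> real) \<Rightarrow> (real \<Rightarrow> real) \<Rightarrow> real" where
  "b_coeff p q =
     3/2 * (LINT x|unit_leb. (LINT y|lebesgue_on {0..x}. p (inv_into {0..1} (phi q) y))\<^sup>2)"

text \<open>
  The covector $(\frac{D}{Dt}\dot q)^\flat$ at time \<open>t\<close>, where \<open>D/Dt\<close> is the covariant derivative of
  \<open>Q\<close> for the metric $G(q)(X,X) = \int_0^1 X^2/\eta(q)\,dx$ (whose flat map is $X \mapsto X/\eta$),
  along a curve \<open>q\<close> in \<open>Q\<close> with $\dot q = \eta(q)\,p$. For $q \in H^2$ the curve \<open>p\<close> is in $H^1$, so its
  norm derivative \<open>L2_deriv p t\<close> exists for almost every \<open>t\<close> and is its weak derivative.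
\<close>

definition cov_deriv_flat ::
    "(real \<Rightarrow> real \<Rightarrow> real) \<Rightarrow> (real \<Rightarrow> real \<Rightarrow> real) \<Rightarrow> real \<Rightarrow> real \<Rightarrow> real" where
  "cov_deriv_flat p q t x =
     (let u = U_fun (\<lambda>y. (p t y)\<^sup>2) (q t) in
       L2_deriv p t x + u x - H2_corr (q t) (vector [0, b_coeff (p t) (q t)]) x
         - (u x - pi_star (q t) u x))"

definition velocity_flat :: "(real \<Rightarrow> real \<Rightarrow> real) \<Rightarrow> real \<Rightarrow> real \<Rightarrow> real" where
  "velocity_flat q t x = L2_deriv q t x / eta (q t) x"

definition geodesic :: "(real \<Rightarrow> real \<Rightarrow> real) \<Rightarrow> bool" where
  "geodesic q \<longleftrightarrow> (\<forall>t\<in>{0..1}. q t \<in> Q_mfd) \<and> C2_curve q \<and>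
     (\<forall>t\<in>{0..1}. L2_eq (cov_deriv_flat (velocity_flat q) q t) (\<lambda>_. 0))"


section \<open>Admissible paths\<close>

type_synonym path = "(real \<Rightarrow> real \<Rightarrow> real) \<times> (real \<Rightarrow> real \<Rightarrow> real)"

text \<open>
  Pairs are ordered as \<open>(p, q)\<close>. Curves in $H^2$ are $C^1$, so $\dot q = \eta(q)\,p$ is required at
  every time, which also gives \<open>p\<close> its pointwise meaning at the end points.
\<close>

definition C0_paths :: "(real \<Rightarrow> real) \<Rightarrow> (real \<Rightarrow> real) \<Rightarrow> path set" where
  "C0_paths q0 p0 = {(p, q).
     (\<forall>t\<in>{0..1}. q t \<in> Q_mfd \<and> p t \<in> cotangent (q t)) \<and>
     H2_curve q \<and>
     (\<forall>t\<in>{0..1}. has_L2_deriv q (\<lambda>x. eta (q t) x * p t x) t) \<and>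
     L2_eq (q 0) q0 \<and> L2_eq (p 0) p0}"

definition C01_paths ::
    "(real \<Rightarrow> real) \<Rightarrow> (real \<Rightarrow> real) \<Rightarrow> (real \<Rightarrow> real) \<Rightarrow> (real \<Rightarrow> real) \<Rightarrow> path set" where
  "C01_paths q0 p0 q1 p1 = {(p, q) \<in> C0_paths q0 p0. L2_eq (q 1) q1 \<and> L2_eq (p 1) p1}"

text \<open>
  A path in \<open>C\<close> is determined by its component \<open>q\<close>, so the $C^2([0,1],L^2)$ topology on \<open>C\<close> is
  that of \<open>q\<close>; it concerns those paths whose \<open>q\<close> is actually $C^2$.
\<close>

definition C2_ball :: "path set \<Rightarrow> (real \<Rightarrow> real \<Rightarrow> real) \<Rightarrow> real \<Rightarrow> path set" where
  "C2_ball C q \<epsilon> = {(p', q') \<in> C. C2_curve q' \<and> C2_norm (\<lambda>t x. q' t x - q t x) < \<epsilon>}"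


section \<open>Measures on the unit square and the Fisher--Rao functional\<close>

abbreviation unit_square :: "(real \<times> real) set" where
  "unit_square \<equiv> {0..1} \<times> {0..1}"

abbreviation square_borel :: "(real \<times> real) measure" where
  "square_borel \<equiv> restrict_space borel unit_square"

text \<open>On the compact square, finite Radon measures are the finite Borel measures.\<close>

definition pos_measure :: "(real \<times> real) measure \<Rightarrow> bool" where
  "pos_measure \<mu> \<longleftrightarrow> finite_measure \<mu> \<and> sets \<mu> = sets square_borel"

text \<open>
  A finite signed measure is represented by a pair of finite positive measures whose difference it
  is. The pair need not be the Jordan decomposition; only the difference is ever used.
\<close>

type_synonym signed = "(real \<times> real) measure \<times> (real \<times> real) measure"

definition signed_measure :: "signed \<Rightarrow> bool" where
  "signed_measure \<nu> \<longleftrightarrow> pos_measure (fst \<nu>) \<and> pos_measure (snd \<nu>)"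

definition of_pos :: "(real \<times> real) measure \<Rightarrow> signed" where
  "of_pos \<mu> = (\<mu>, null_measure square_borel)"

definition signed_integral :: "signed \<Rightarrow> (real \<times> real \<Rightarrow> real) \<Rightarrow> real" where
  "signed_integral \<nu> f = (LINT z|fst \<nu>. f z) - (LINT z|snd \<nu>. f z)"

definition dominates :: "(real \<times> real) measure \<Rightarrow> signed \<Rightarrow> bool" where
  "dominates l \<nu> \<longleftrightarrow> absolutely_continuous l (fst \<nu>) \<and> absolutely_continuous l (snd \<nu>)"

definition signed_RN :: "(real \<times> real) measure \<Rightarrow> signed \<Rightarrow> real \<times> real \<Rightarrow> real" where
  "signed_RN l \<nu> z = enn2real (RN_deriv l (fst \<nu>) z) - enn2real (RN_deriv l (snd \<nu>) z)"

definition FR_integrand :: "real \<Rightarrow> real \<Rightarrow> ennreal" where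
  "FR_integrand x y =
     (if x > 0 then ennreal (1/4 * (y\<^sup>2 / x)) else if x = 0 \<and> y = 0 then 0 else \<infinity>)"

text \<open>
  The integrand is positively homogeneous of degree one, so the integral is the same for all
  dominating \<open>l\<close>; the infimum merely selects this common value.
\<close>

definition FR :: "(real \<times> real \<Rightarrow> real) \<Rightarrow> signed \<Rightarrow> signed \<Rightarrow> ennreal" where
  "FR f \<mu> \<nu> = (INF l \<in> {l. pos_measure l \<and> dominates l \<mu> \<and> dominates l \<nu>}.
     \<integral>\<^sup>+ z. FR_integrand (signed_RN l \<mu> z) (signed_RN l \<nu> z) * ennreal (f z) \<partial>l)"

text \<open>
  $\Delta_{t=0} = 0$ and $\partial_t\Delta = \delta$ in the weak sense: the test functions need not
  vanish at \<open>t = 0\<close>, so the identity contains the initial condition. Here \<open>g\<close> is the partial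
  derivative of \<open>f\<close> in time.
\<close>

definition time_derivative :: "(real \<times> real) measure \<Rightarrow> signed \<Rightarrow> bool" where
  "time_derivative \<Delta> \<delta> \<longleftrightarrow> signed_measure \<delta> \<and>
     (\<forall>f g. continuous_on unit_square f \<longrightarrow> continuous_on unit_square g \<longrightarrow>
        (\<forall>t\<in>{0..1}. \<forall>x\<in>{0..1}.
           ((\<lambda>s. f (s, x)) has_real_derivative g (t, x)) (at t within {0..1})) \<longrightarrow>
        (\<forall>x\<in>{0..1}. f (1, x) = 0) \<longrightarrow>
        (LINT z|\<Delta>. g z) + signed_integral \<delta> f = 0)"

text \<open>$\Delta = \Delta_t\,dt$ with finite measures $\Delta_t = $ \<open>K t\<close> on $[0,1]$.\<close>

definition disintegration :: "(real \<times> real) measure \<Rightarrow> (real \<Rightarrow> real measure) \<Rightarrow> bool" where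
  "disintegration \<Delta> K \<longleftrightarrow>
     (\<forall>t\<in>{0..1}. finite_measure (K t) \<and> sets (K t) = sets (restrict_space borel {0..1})) \<and>
     (\<forall>A\<in>sets square_borel.
        (\<lambda>t. emeasure (K t) {x. (t, x) \<in> A}) \<in> borel_measurable unit_leb \<and>
        emeasure \<Delta> A = (\<integral>\<^sup>+ t. emeasure (K t) {x. (t, x) \<in> A} \<partial>unit_leb))"

definition U_meas :: "real measure \<Rightarrow> (real \<Rightarrow> real) \<Rightarrow> real \<Rightarrow> real" where
  "U_meas m q x = 1/2 * (LINT y:{x..1}|m. eta q y)"


section \<open>The functional\<close>

text \<open>
  No condition at \<open>t = 0\<close> is listed here: it is part of \<open>time_derivative\<close>, and \<open>energy\<close> below is
  infinite for measures violating it.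
\<close>

definition M0 :: "(real \<times> real) measure set" where
  "M0 = {\<Delta>. pos_measure \<Delta>}"

text \<open>
  If $\partial_t\Delta$ is a finite measure then $\Delta = \Delta_t\,dt$ with $\Delta_t$ unique for
  almost every \<open>t\<close>, and $\partial_t\Delta$ is unique up to mass on \<open>t = 1\<close>, which the test functions do
  not see; as $\Delta$ does not charge \<open>t = 1\<close>, any such mass makes the Fisher--Rao term infinite. So
  the infimum selects the value at the derivative without mass on \<open>t = 1\<close>, and it is the infimum of the
  empty set, namely infinity, if $\partial_t\Delta$ is not a finite measure.
\<close>

definition energy :: "((real \<Rightarrow> real) \<Rightarrow> (real \<Rightarrow> real) \<Rightarrow> real) \<Rightarrow> (real \<times> real) measure \<Rightarrow>
    (real \<Rightarrow> real \<Rightarrow> real) \<Rightarrow> (real \<Rightarrow> real \<Rightarrow> real) \<Rightarrow> ereal" where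
  "energy P \<Delta> p q =
     enn2ereal (INF (\<delta>, K) \<in> {(\<delta>, K). time_derivative \<Delta> \<delta> \<and> disintegration \<Delta> K}.
       FR (\<lambda>(t, x). eta (q t) x) (of_pos \<Delta>) \<delta> +
       (\<integral>\<^sup>+ t. ennreal (norm_sq_at (q t)
          (\<lambda>x. cov_deriv_flat p q t x + pi_star (q t) (U_meas (K t) (q t)) x)) \<partial>unit_leb))
     + ereal (P (p 1) (q 1))"

definition optimal_at_zero ::
    "((real \<Rightarrow> real) \<Rightarrow> (real \<Rightarrow> real) \<Rightarrow> real) \<Rightarrow> path set \<Rightarrow> path set" where
  "optimal_at_zero P C = {(p, q) \<in> C.
     \<forall>\<Delta>\<in>M0. energy P (null_measure square_borel) p q \<le> energy P \<Delta> p q}"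

end

theory Submission
  imports Defs
begin

text \<open>
  Write \<open>A\<close> for the covector of the acceleration. Expanding the square, the second term of the
  functional changes by at least \<open>- C \<parallel>A\<parallel> \<kappa>(t)\<close> at time \<open>t\<close>, where \<open>\<kappa>(t)\<close> is the mass of $\Delta_t$. Since
  $r(x,y) \ge b y - b^2 x$ for every \<open>b\<close>, testing $\partial_t\Delta$ with \<open>b = (1 - t) / 2\<close>, for which
  $-\dot b - b^2 \ge 1/4$, bounds the Fisher--Rao term from below by a multiple of the total mass
  of $\Delta$. So \<open>\<Delta> = 0\<close> is optimal as soon as \<open>\<parallel>A\<parallel>\<close> is uniformly small in time. Now \<open>A\<close> vanishes along
  a geodesic and is a continuous function of $(q,\dot q,\ddot q) \in L^2$; by compactness of the time
  interval it is small on a whole $C^2$ neighbourhood.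
\<close>

section \<open>Square-integrable functions on the unit interval\<close>

text \<open>The obstacle is that \<open>A\<close> is given through \<open>p\<close>, the inverse of
  \<open>phi\<close> and a derivative \<open>L2_deriv p t\<close> fixed only up to null sets, while
  the neighbourhood controls \<open>q\<close> and its time derivatives. So \<open>A\<close> is
  rewritten as \<open>cov_acc q v a\<close>, with \<open>v\<close> and \<open>a\<close> the first
  and second derivative: \<open>p\<close> is \<open>v / eta q\<close>, whose derivative comes from
  the quotient rule, and the substitution \<open>y = phi q x\<close> removes the inverse. Each term
  of \<open>cov_acc\<close> is then continuous in x, or a continuous function times an element of
  L2; squares of L2 functions occur only under an integral in x. This is what makes
  \<open>cov_acc\<close> norm continuous. The constants are uniform on the neighbourhood because
  \<open>primitive q\<close> is bounded by the L2 norm of \<open>q\<close>, which keeps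
  \<open>eta\<close> between \<open>exp (- R)\<close> and \<open>exp R\<close>. Measurability in
  time of the integrands of the functional is not established. Their integrals are therefore
  compared pointwise, and the one sum that has to be split has a measurable summand.\<close>

lemma L2_borel_measurable: "f \<in> L2 \<Longrightarrow> f \<in> borel_measurable unit_leb"
  by (simp add: L2_def)

lemma L2_integrable_mult:
  assumes "f \<in> L2" "g \<in> L2"
  shows "integrable unit_leb (\<lambda>x. f x * g x)"
proof (rule Bochner_Integration.integrable_bound)
  show "integrable unit_leb (\<lambda>x. (f x)\<^sup>2 + (g x)\<^sup>2)"
    using assms by (simp add: L2_def)
  show "(\<lambda>x. f x * g x) \<in> borel_measurable unit_leb"
    using assms[THEN L2_borel_measurable] by measurable
  show "AE x in unit_leb. norm (f x * g x) \<le> norm ((f x)\<^sup>2 + (g x)\<^sup>2)"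
  proof (intro AE_I2)
    fix x
    have "0 \<le> (\<bar>f x\<bar> - \<bar>g x\<bar>)\<^sup>2 + (f x)\<^sup>2 + (g x)\<^sup>2" by simp
    then show "norm (f x * g x) \<le> norm ((f x)\<^sup>2 + (g x)\<^sup>2)"
      by (simp add: power2_diff abs_mult)
  qed
qed

lemma finite_measure_unit_leb [simp]: "finite_measure unit_leb"
  by (simp add: finite_measure_lebesgue_on)

lemma L2_bounded:
  assumes "f \<in> borel_measurable unit_leb" "\<And>x. x \<in> {0..1} \<Longrightarrow> \<bar>f x\<bar> \<le> B"
  shows "f \<in> L2"
proof -
  have "integrable unit_leb (\<lambda>x. (f x)\<^sup>2)"
  proof (rule finite_measure.integrable_const_bound[where B="B\<^sup>2"])
    show "AE x in unit_leb. norm ((f x)\<^sup>2) \<le> B\<^sup>2"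
    proof (intro AE_I2)
      fix x :: real assume "x \<in> space unit_leb"
      then have "\<bar>f x\<bar> \<le> \<bar>B\<bar>" using assms(2)[of x] by auto
      then show "norm ((f x)\<^sup>2) \<le> B\<^sup>2" by (simp add: abs_le_square_iff)
    qed
  qed (use assms(1) in auto)
  then show ?thesis using assms(1) by (simp add: L2_def)
qed

lemma L2_const [simp]: "(\<lambda>_. c) \<in> L2"
  by (rule L2_bounded[where B="\<bar>c\<bar>"]) auto

lemma L2_add:
  assumes "f \<in> L2" "g \<in> L2"
  shows "(\<lambda>x. f x + g x) \<in> L2"
proof -
  have "integrable unit_leb (\<lambda>x. (f x)\<^sup>2 + (g x)\<^sup>2 + 2 * (f x * g x))"
    using assms L2_integrable_mult[OF assms] by (simp add: L2_def)
  then have "integrable unit_leb (\<lambda>x. (f x + g x)\<^sup>2)"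
    by (simp add: power2_sum algebra_simps)
  then show ?thesis using assms[THEN L2_borel_measurable] by (simp add: L2_def)
qed

lemma L2_bounded_mult:
  assumes "f \<in> L2" "h \<in> borel_measurable unit_leb" "\<And>x. x \<in> {0..1} \<Longrightarrow> \<bar>h x\<bar> \<le> B"
  shows "(\<lambda>x. h x * f x) \<in> L2"
proof -
  have "integrable unit_leb (\<lambda>x. (h x * f x)\<^sup>2)"
  proof (rule Bochner_Integration.integrable_bound)
    show "integrable unit_leb (\<lambda>x. B\<^sup>2 * (f x)\<^sup>2)"
      using assms by (simp add: L2_def)
    show "AE x in unit_leb. norm ((h x * f x)\<^sup>2) \<le> norm (B\<^sup>2 * (f x)\<^sup>2)"
    proof (intro AE_I2)
      fix x :: real assume "x \<in> space unit_leb"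
      then have "\<bar>h x\<bar> \<le> \<bar>B\<bar>" using assms(3)[of x] by auto
      then have "(h x)\<^sup>2 \<le> B\<^sup>2" by (simp add: abs_le_square_iff)
      then show "norm ((h x * f x)\<^sup>2) \<le> norm (B\<^sup>2 * (f x)\<^sup>2)"
        by (simp add: power_mult_distrib mult_right_mono)
    qed
    show "(\<lambda>x. (h x * f x)\<^sup>2) \<in> borel_measurable unit_leb"
      using L2_borel_measurable[OF assms(1)] assms(2) by measurable
  qed
  then show ?thesis using L2_borel_measurable[OF assms(1)] assms(2) by (simp add: L2_def)
qed

lemma L2_cmult: "f \<in> L2 \<Longrightarrow> (\<lambda>x. c * f x) \<in> L2"
  by (rule L2_bounded_mult[where B="\<bar>c\<bar>"]) auto

lemma L2_uminus: "f \<in> L2 \<Longrightarrow> (\<lambda>x. - f x) \<in> L2"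
  using L2_cmult[of f "-1"] by simp

lemma L2_diff: "f \<in> L2 \<Longrightarrow> g \<in> L2 \<Longrightarrow> (\<lambda>x. f x - g x) \<in> L2"
  using L2_add[OF _ L2_uminus, of f g] by simp

lemma L2_divide: "f \<in> L2 \<Longrightarrow> (\<lambda>x. f x / c) \<in> L2"
  using L2_cmult[of f "inverse c"] by (simp add: field_simps)

lemma L2_indicator: "f \<in> L2 \<Longrightarrow> A \<in> sets lebesgue \<Longrightarrow> (\<lambda>x. indicator A x * f x) \<in> L2"
  by (rule L2_bounded_mult[where B=1]) (auto simp: indicator_def intro!: measurable_restrict_space1)

lemma L2_integrable: "f \<in> L2 \<Longrightarrow> integrable unit_leb f"
  using L2_integrable_mult[of f "\<lambda>_. 1"] by simp

section \<open>The L2 norm and the Cauchy-Schwarz inequality\<close>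

lemma L2_norm_nonneg [simp]: "0 \<le> L2_norm f"
  by (simp add: L2_norm_def L2_inner_def)

lemma L2_norm_power2: "(L2_norm f)\<^sup>2 = (LINT x|unit_leb. (f x)\<^sup>2)"
  by (simp add: L2_norm_def L2_inner_def power2_eq_square)

lemma L2_norm_minus_commute: "L2_norm (\<lambda>x. f x - g x) = L2_norm (\<lambda>x. g x - f x)"
  by (simp add: L2_norm_def L2_inner_def algebra_simps)

lemma L2_norm_cmult: "L2_norm (\<lambda>x. c * f x) = \<bar>c\<bar> * L2_norm f"
proof -
  have "L2_inner (\<lambda>x. c * f x) (\<lambda>x. c * f x) = c\<^sup>2 * L2_inner f f"
    by (simp add: L2_inner_def power2_eq_square algebra_simps)
  then show ?thesis
    by (simp add: L2_norm_def real_sqrt_mult)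
qed

lemma L2_norm_mono:
  assumes "f \<in> L2" "g \<in> L2" "\<And>x. x \<in> {0..1} \<Longrightarrow> \<bar>f x\<bar> \<le> \<bar>g x\<bar>"
  shows "L2_norm f \<le> L2_norm g"
proof -
  have "(LINT x|unit_leb. (f x)\<^sup>2) \<le> (LINT x|unit_leb. (g x)\<^sup>2)"
    using assms by (intro integral_mono) (auto simp: L2_def abs_le_square_iff)
  then show ?thesis
    by (simp add: L2_norm_def L2_inner_def power2_eq_square)
qed

lemma L2_norm_const [simp]: "L2_norm (\<lambda>_. c) = \<bar>c\<bar>"
  using L2_norm_cmult[of c "\<lambda>_. 1"]
  by (simp add: L2_norm_def L2_inner_def measure_restrict_space)

lemma L2_norm_le_bound:
  assumes "f \<in> borel_measurable unit_leb" "\<And>x. x \<in> {0..1} \<Longrightarrow> \<bar>f x\<bar> \<le> B"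
  shows "L2_norm f \<le> B"
proof -
  have "0 \<le> B" using assms(2)[of 0] by simp
  then show ?thesis
    using L2_norm_mono[OF L2_bounded[OF assms] L2_const, of B] assms(2) by simp
qed

lemma L2_norm_bounded_mult:
  assumes "f \<in> L2" "h \<in> borel_measurable unit_leb" "\<And>x. x \<in> {0..1} \<Longrightarrow> \<bar>h x\<bar> \<le> B"
  shows "L2_norm (\<lambda>x. h x * f x) \<le> B * L2_norm f"
proof -
  have B: "0 \<le> B" using assms(3)[of 0] by simp
  have "L2_norm (\<lambda>x. h x * f x) \<le> L2_norm (\<lambda>x. B * f x)"
    using B by (intro L2_norm_mono L2_bounded_mult[OF assms] L2_cmult assms)
      (auto simp: abs_mult intro!: mult_right_mono assms(3))
  then show ?thesis using B by (simp add: L2_norm_cmult)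
qed

text \<open>Integrating the square of \<open>s * \<bar>f x\<bar> - t * \<bar>g x\<bar>\<close> gives
  a nonnegative quadratic form in \<open>s\<close> and \<open>t\<close>. Evaluating it at
  \<open>s = L2_norm g\<close>, \<open>t = L2_norm f\<close> yields the bound when both norms are
  positive.\<close>

lemma L2_Cauchy_Schwarz_abs:
  assumes "f \<in> L2" "g \<in> L2"
  shows "(LINT x|unit_leb. \<bar>f x * g x\<bar>) \<le> L2_norm f * L2_norm g"
proof -
  define I where "I = (LINT x|unit_leb. \<bar>f x * g x\<bar>)"
  have *: "2 * (s * t) * I \<le> s\<^sup>2 * (L2_norm f)\<^sup>2 + t\<^sup>2 * (L2_norm g)\<^sup>2" for s t
  proof -
    have "0 \<le> (LINT x|unit_leb. (s * \<bar>f x\<bar> - t * \<bar>g x\<bar>)\<^sup>2)" by simp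
    also have "\<dots> = (LINT x|unit_leb. s\<^sup>2 * (f x)\<^sup>2 + t\<^sup>2 * (g x)\<^sup>2 - 2 * (s * t) * \<bar>f x * g x\<bar>)"
      by (simp add: power2_diff power_mult_distrib abs_mult algebra_simps)
    also have "\<dots> = s\<^sup>2 * (L2_norm f)\<^sup>2 + t\<^sup>2 * (L2_norm g)\<^sup>2 - 2 * (s * t) * I"
      unfolding I_def L2_norm_power2 using assms L2_integrable_mult[OF assms]
      by (simp add: L2_def)
    finally show ?thesis by simp
  qed
  show ?thesis
  proof (cases "L2_norm f = 0 \<or> L2_norm g = 0")
    case True
    have "I \<le> 0"
    proof (rule ccontr)
      assume "\<not> I \<le> 0"
      then have I: "I > 0" by simp
      have pos: "0 \<le> (L2_norm f)\<^sup>2" "0 \<le> (L2_norm g)\<^sup>2" by simp_all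
      from True show False
      proof
        assume z: "L2_norm f = 0"
        \<comment> \<open>This \<open>s\<close> makes the left side of the inequality
          \<open>2 * ((L2_norm g)\<^sup>2 + 1)\<close>, while the right side stays
          \<open>(L2_norm g)\<^sup>2\<close>.\<close>
        show False using *[of "((L2_norm g)\<^sup>2 + 1) / I" 1] I pos by (simp add: z)
      next
        assume z: "L2_norm g = 0"
        show False using *[of 1 "((L2_norm f)\<^sup>2 + 1) / I"] I pos by (simp add: z)
      qed
    qed
    then show ?thesis using True by (auto simp: I_def)
  next
    case False
    then have p: "L2_norm f > 0" "L2_norm g > 0" by (simp_all add: order_less_le)
    have "2 * (L2_norm g * L2_norm f) * I \<le> 2 * (L2_norm g * L2_norm f) * (L2_norm f * L2_norm g)"
      using *[of "L2_norm g" "L2_norm f"] by (simp add: power2_eq_square algebra_simps)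
    then show ?thesis using p by (simp add: I_def)
  qed
qed

lemma L2_Cauchy_Schwarz:
  assumes "f \<in> L2" "g \<in> L2"
  shows "\<bar>LINT x|unit_leb. f x * g x\<bar> \<le> L2_norm f * L2_norm g"
  using L2_Cauchy_Schwarz_abs[OF assms] integral_abs_bound[of unit_leb "\<lambda>x. f x * g x"]
  by linarith

lemma L2_norm_triangle:
  assumes "f \<in> L2" "g \<in> L2"
  shows "L2_norm (\<lambda>x. f x + g x) \<le> L2_norm f + L2_norm g"
proof (rule power2_le_imp_le)
  have "(L2_norm (\<lambda>x. f x + g x))\<^sup>2 = (LINT x|unit_leb. (f x)\<^sup>2 + (g x)\<^sup>2 + 2 * (f x * g x))"
    by (simp add: L2_norm_power2 power2_sum mult.assoc)
  also have "\<dots> = (L2_norm f)\<^sup>2 + (L2_norm g)\<^sup>2 + 2 * (LINT x|unit_leb. f x * g x)"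
    using assms L2_integrable_mult[OF assms] by (simp add: L2_norm_power2 L2_def)
  also have "\<dots> \<le> (L2_norm f + L2_norm g)\<^sup>2"
    using L2_Cauchy_Schwarz[OF assms] by (simp add: power2_sum)
  finally show "(L2_norm (\<lambda>x. f x + g x))\<^sup>2 \<le> (L2_norm f + L2_norm g)\<^sup>2" .
qed simp

lemma L2_norm_triangle_diff:
  assumes "f \<in> L2" "g \<in> L2"
  shows "L2_norm f \<le> L2_norm (\<lambda>x. f x - g x) + L2_norm g"
  using L2_norm_triangle[OF L2_diff[OF assms] assms(2)] by simp

lemma L2_norm_cong_AE:
  assumes "f \<in> L2" "g \<in> L2" "AE x in unit_leb. f x = g x"
  shows "L2_norm f = L2_norm g"
  unfolding L2_norm_def L2_inner_def using assms
  by (intro arg_cong[where f=sqrt] integral_cong_AE) (auto simp: L2_def elim!: AE_mp)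

lemma L2_norm_eq_0_AE:
  assumes "f \<in> L2" "L2_norm f = 0"
  shows "AE x in unit_leb. f x = 0"
proof -
  have "AE x in unit_leb. (f x)\<^sup>2 = 0"
    using assms L2_norm_power2[of f]
    by (subst integral_nonneg_eq_0_iff_AE[symmetric]) (auto simp: L2_def)
  then show ?thesis by simp
qed

lemma L2_norm_zero_AE:
  assumes "f \<in> L2" "AE x in unit_leb. f x = 0"
  shows "L2_norm f = 0"
  using L2_norm_cong_AE[OF assms(1) L2_const assms(2)] by simp

section \<open>Integrals over subsets of the unit interval\<close>

lemma integral_lebesgue_on_sub:
  fixes f :: "real \<Rightarrow> real"
  assumes "A \<in> sets lebesgue" "A \<subseteq> {0..1}"
  shows "(LINT x|lebesgue_on A. f x) = (LINT x|unit_leb. indicator A x * f x)"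
proof -
  have "(LINT x|lebesgue_on A. f x) = (LINT x|lebesgue. indicator A x * f x)"
    using assms by (subst integral_restrict_space) auto
  also have "\<dots> = (LINT x|lebesgue. indicator {0..1} x * (indicator A x * f x))"
    using assms(2) by (intro Bochner_Integration.integral_cong) (auto simp: indicator_def)
  also have "\<dots> = (LINT x|unit_leb. indicator A x * f x)"
    by (subst integral_restrict_space) auto
  finally show ?thesis .
qed

lemma integral_lebesgue_on_sub_cong_AE:
  fixes f g :: "real \<Rightarrow> real"
  assumes "A \<in> sets lebesgue" "A \<subseteq> {0..1}" "AE x in unit_leb. f x = g x"
    and "f \<in> borel_measurable unit_leb" "g \<in> borel_measurable unit_leb"
  shows "(LINT x|lebesgue_on A. f x) = (LINT x|lebesgue_on A. g x)"
proof -
  have "indicator A \<in> borel_measurable unit_leb"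
    using assms(1) by (intro measurable_restrict_space1) auto
  then show ?thesis
    unfolding integral_lebesgue_on_sub[OF assms(1,2)] using assms(3-5)
    by (intro integral_cong_AE borel_measurable_times) (auto elim: eventually_mono intro: measurable_restrict_space1)
qed

lemma L2_Cauchy_Schwarz_on:
  assumes "f \<in> L2" "g \<in> L2" "A \<in> sets lebesgue" "A \<subseteq> {0..1}"
  shows "\<bar>LINT x|lebesgue_on A. f x * g x\<bar> \<le> L2_norm f * L2_norm g"
proof -
  have "\<bar>LINT x|lebesgue_on A. f x * g x\<bar> \<le> L2_norm (\<lambda>x. indicator A x * f x) * L2_norm g"
    using L2_Cauchy_Schwarz[OF L2_indicator[OF assms(1,3)] assms(2)]
    unfolding integral_lebesgue_on_sub[OF assms(3,4)] by (simp only: mult.assoc)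
  also have "\<dots> \<le> L2_norm f * L2_norm g"
    by (intro mult_right_mono L2_norm_mono L2_indicator assms) (auto simp: indicator_def)
  finally show ?thesis .
qed

lemma L2_integral_on_bound:
  assumes "f \<in> L2" "A \<in> sets lebesgue" "A \<subseteq> {0..1}"
  shows "\<bar>LINT x|lebesgue_on A. f x\<bar> \<le> L2_norm f"
  using L2_Cauchy_Schwarz_on[OF assms(1) L2_const[of 1] assms(2,3)] by simp

lemma integrable_on_sub:
  fixes f :: "real \<Rightarrow> real"
  assumes "integrable unit_leb f" "A \<in> sets lebesgue" "A \<subseteq> {0..1}"
  shows "integrable (lebesgue_on A) f"
proof -
  have "integrable lebesgue (\<lambda>x. indicator {0..1} x *\<^sub>R f x)"
    using assms(1) by (subst (asm) integrable_restrict_space) auto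
  then have "integrable lebesgue (\<lambda>x. indicator A x *\<^sub>R (indicator {0..1} x *\<^sub>R f x))"
    using assms(2) by (rule integrable_mult_indicator[rotated])
  moreover have "(\<lambda>x. indicator A x *\<^sub>R (indicator {0..1} x *\<^sub>R f x)) = (\<lambda>x. indicator A x *\<^sub>R f x)"
    using assms(3) by (auto simp: indicator_def fun_eq_iff)
  ultimately have "integrable lebesgue (\<lambda>x. indicator A x *\<^sub>R f x)" by (simp only:)
  then show ?thesis using assms(2) by (subst integrable_restrict_space) simp_all
qed


section \<open>Convergence in $L^2$ and uniform convergence\<close>

lemma continuous_on_integral_from_0:
  assumes "integrable unit_leb (f :: real \<Rightarrow> real)"
  shows "continuous_on {0..1} (\<lambda>x. LINT y|lebesgue_on {0..x}. f y)"
proof -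
  have "f integrable_on {0..1}"
    using assms by (simp add: integrable_on_lebesgue_on)
  then have "continuous_on {0..1} (\<lambda>x. integral {0..x} f)"
    by (rule indefinite_integral_continuous_1)
  moreover have "integral {0..x} f = (LINT y|lebesgue_on {0..x}. f y)" if "x \<in> {0..1}" for x
    using that by (intro lebesgue_integral_eq_integral[symmetric] integrable_on_sub[OF assms]) auto
  ultimately show ?thesis by (rule continuous_on_eq)
qed

lemma integral_from_0_to_1_split:
  assumes "integrable unit_leb (f :: real \<Rightarrow> real)" "x \<in> {0..1}"
  shows "(LINT y|lebesgue_on {x..1}. f y) = (LINT y|unit_leb. f y) - (LINT y|lebesgue_on {0..x}. f y)"
proof -
  have i: "integral {0..1} f = (LINT y|unit_leb. f y)" "integral {0..x} f = (LINT y|lebesgue_on {0..x}. f y)"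
    "integral {x..1} f = (LINT y|lebesgue_on {x..1}. f y)"
    using assms by (auto intro!: lebesgue_integral_eq_integral[symmetric] integrable_on_sub[OF assms(1)])
  have "f integrable_on {0..1}"
    using assms by (simp add: integrable_on_lebesgue_on)
  then have "integral {0..x} f + integral {x..1} f = integral {0..1} f"
    using assms(2) by (intro Henstock_Kurzweil_Integration.integral_combine) auto
  then show ?thesis by (simp add: i)
qed

lemma continuous_on_integral_to_1:
  assumes "integrable unit_leb (f :: real \<Rightarrow> real)"
  shows "continuous_on {0..1} (\<lambda>x. LINT y|lebesgue_on {x..1}. f y)"
proof -
  have "continuous_on {0..1} (\<lambda>x. (LINT y|unit_leb. f y) - (LINT y|lebesgue_on {0..x}. f y))"
    using continuous_on_integral_from_0[OF assms] by (intro continuous_intros)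
  then show ?thesis
    by (rule continuous_on_eq) (rule integral_from_0_to_1_split[OF assms, symmetric])
qed

lemma continuous_on_borel_measurable_unit:
  "continuous_on {0..1} f \<Longrightarrow> (f :: real \<Rightarrow> real) \<in> borel_measurable unit_leb"
  by (rule continuous_imp_measurable_on_sets_lebesgue) auto

lemma continuous_on_unit_bounded:
  assumes "continuous_on {0..1} (f :: real \<Rightarrow> real)"
  obtains B where "\<And>x. x \<in> {0..1} \<Longrightarrow> \<bar>f x\<bar> \<le> B"
proof -
  have "compact (f ` {0..1})"
    using assms by (intro compact_continuous_image) auto
  then have "bounded (f ` {0..1})" by (rule compact_imp_bounded)
  then show ?thesis using that unfolding bounded_iff by (metis imageI real_norm_def)
qed

text \<open>Two modes of convergence are kept apart because a product of two L2 limits need not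
  converge in L2. A uniform limit times an L2 limit is again an L2 limit
  (\<open>L2_limit_mult\<close>), and integrating a product of two L2 limits up to x gives a uniform
  limit (\<open>unif_limit_integral_from_0\<close>). Membership in \<open>L2\<close> is demanded
  explicitly because \<open>L2_norm f\<close> has the default value 0 when the square of
  \<open>f\<close> is not integrable.\<close>

definition L2_limit :: "('i \<Rightarrow> real \<Rightarrow> real) \<Rightarrow> (real \<Rightarrow> real) \<Rightarrow> 'i filter \<Rightarrow> bool" where
  "L2_limit f g F \<longleftrightarrow> g \<in> L2 \<and> (\<forall>\<^sub>F n in F. f n \<in> L2) \<and>
     ((\<lambda>n. L2_norm (\<lambda>x. f n x - g x)) \<longlongrightarrow> 0) F"

text \<open>Continuity is built in as it supplies both measurability and boundedness on the compact
  interval; the latter is what lets uniform limits be multiplied.\<close>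

definition unif_limit :: "('i \<Rightarrow> real \<Rightarrow> real) \<Rightarrow> (real \<Rightarrow> real) \<Rightarrow> 'i filter \<Rightarrow> bool" where
  "unif_limit f g F \<longleftrightarrow> continuous_on {0..1} g \<and>
     (\<forall>\<^sub>F n in F. continuous_on {0..1} (f n)) \<and> uniform_limit {0..1} f g F"

lemma L2_limit_cong_AE:
  assumes "L2_limit f g F" "\<forall>\<^sub>F n in F. f' n \<in> L2 \<and> (AE x in unit_leb. f' n x = f n x)"
  shows "L2_limit f' g F"
proof -
  have "\<forall>\<^sub>F n in F. L2_norm (\<lambda>x. f n x - g x) = L2_norm (\<lambda>x. f' n x - g x)"
    using assms(2) assms(1)[unfolded L2_limit_def, THEN conjunct2, THEN conjunct1]
  proof eventually_elim
    case (elim n)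
    show ?case
      by (intro L2_norm_cong_AE L2_diff) (use elim assms(1) in \<open>auto simp: L2_limit_def\<close>)
  qed
  then have "((\<lambda>n. L2_norm (\<lambda>x. f' n x - g x)) \<longlongrightarrow> 0) F"
    using assms(1) by (auto simp: L2_limit_def intro: tendsto_cong[THEN iffD1])
  then show ?thesis using assms by (auto simp: L2_limit_def elim: eventually_mono)
qed

lemma L2_limit_const: "f \<in> L2 \<Longrightarrow> L2_limit (\<lambda>_. f) f F"
  by (simp add: L2_limit_def)

lemma L2_limit_norm_bound:
  assumes "g \<in> L2" "\<forall>\<^sub>F n in F. f n \<in> L2 \<and> L2_norm (\<lambda>x. f n x - g x) \<le> e n" "(e \<longlongrightarrow> 0) F"
  shows "L2_limit f g F"
proof -
  have "((\<lambda>n. L2_norm (\<lambda>x. f n x - g x)) \<longlongrightarrow> 0) F"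
    by (rule tendsto_sandwich[OF _ _ tendsto_const assms(3)])
      (use assms(2) in \<open>auto elim: eventually_mono\<close>)
  then show ?thesis using assms by (auto simp: L2_limit_def elim: eventually_mono)
qed

lemma L2_limit_add:
  assumes "L2_limit f f' F" "L2_limit g g' F"
  shows "L2_limit (\<lambda>n x. f n x + g n x) (\<lambda>x. f' x + g' x) F"
proof (rule L2_limit_norm_bound)
  show "(\<lambda>x. f' x + g' x) \<in> L2" using assms by (auto simp: L2_limit_def intro: L2_add)
  have "\<forall>\<^sub>F n in F. f n \<in> L2" "\<forall>\<^sub>F n in F. g n \<in> L2" using assms by (auto simp: L2_limit_def)
  then show "\<forall>\<^sub>F n in F. (\<lambda>x. f n x + g n x) \<in> L2 \<and> L2_norm (\<lambda>x. f n x + g n x - (f' x + g' x)) \<le>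
      L2_norm (\<lambda>x. f n x - f' x) + L2_norm (\<lambda>x. g n x - g' x)"
  proof eventually_elim
    case (elim n)
    then show ?case
      using L2_norm_triangle[of "\<lambda>x. f n x - f' x" "\<lambda>x. g n x - g' x"] assms
      by (auto simp: L2_limit_def L2_diff L2_add algebra_simps)
  qed
  show "((\<lambda>n. L2_norm (\<lambda>x. f n x - f' x) + L2_norm (\<lambda>x. g n x - g' x)) \<longlongrightarrow> 0) F"
    using assms by (auto simp: L2_limit_def intro: tendsto_add_zero)
qed

lemma L2_limit_cmult:
  assumes "L2_limit f f' F"
  shows "L2_limit (\<lambda>n x. c * f n x) (\<lambda>x. c * f' x) F"
proof (rule L2_limit_norm_bound)
  show "(\<lambda>x. c * f' x) \<in> L2" using assms by (auto simp: L2_limit_def intro: L2_cmult)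
  have "\<forall>\<^sub>F n in F. f n \<in> L2" using assms by (auto simp: L2_limit_def)
  then show "\<forall>\<^sub>F n in F. (\<lambda>x. c * f n x) \<in> L2 \<and>
      L2_norm (\<lambda>x. c * f n x - c * f' x) \<le> \<bar>c\<bar> * L2_norm (\<lambda>x. f n x - f' x)"
    by eventually_elim (auto simp: L2_cmult L2_norm_cmult simp flip: right_diff_distrib)
  show "((\<lambda>n. \<bar>c\<bar> * L2_norm (\<lambda>x. f n x - f' x)) \<longlongrightarrow> 0) F"
    using assms by (auto simp: L2_limit_def intro: tendsto_mult_right_zero)
qed

lemma L2_limit_diff:
  assumes "L2_limit f f' F" "L2_limit g g' F"
  shows "L2_limit (\<lambda>n x. f n x - g n x) (\<lambda>x. f' x - g' x) F"
  using L2_limit_add[OF assms(1) L2_limit_cmult[OF assms(2), of "-1"]] by simp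

lemma L2_limit_norm:
  assumes "L2_limit f f' F"
  shows "((\<lambda>n. L2_norm (f n)) \<longlongrightarrow> L2_norm f') F"
proof -
  have "((\<lambda>n. L2_norm (f n) - L2_norm f') \<longlongrightarrow> 0) F"
  proof (rule tendsto_rabs_zero_cancel, rule tendsto_sandwich[OF _ _ tendsto_const])
    show "((\<lambda>n. L2_norm (\<lambda>x. f n x - f' x)) \<longlongrightarrow> 0) F" using assms by (simp add: L2_limit_def)
    have "\<forall>\<^sub>F n in F. f n \<in> L2" using assms by (auto simp: L2_limit_def)
    then show "\<forall>\<^sub>F n in F. \<bar>L2_norm (f n) - L2_norm f'\<bar> \<le> L2_norm (\<lambda>x. f n x - f' x)"
    proof eventually_elim
      case (elim n)
      then show ?case
        using L2_norm_triangle_diff[of "f n" f'] L2_norm_triangle_diff[of f' "f n"] assms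
          L2_norm_minus_commute[of "f n" f'] by (auto simp: L2_limit_def)
    qed
  qed auto
  then show ?thesis by (simp add: LIM_zero_iff)
qed

text \<open>The unit interval has measure 1, so the L2 norm is at most the supremum norm.\<close>

lemma unif_limit_imp_L2_limit:
  assumes "unif_limit f f' F"
  shows "L2_limit f f' F"
proof -
  have in_L2: "h \<in> L2" if "continuous_on {0..1} h" for h
    by (rule continuous_on_unit_bounded[OF that]) (rule L2_bounded[OF continuous_on_borel_measurable_unit[OF that]])
  have "((\<lambda>n. L2_norm (\<lambda>x. f n x - f' x)) \<longlongrightarrow> 0) F"
  proof (rule tendstoI)
    fix e :: real assume e: "e > 0"
    then have "e / 2 > 0" by simp
    then have "\<forall>\<^sub>F n in F. \<forall>x\<in>{0..1}. dist (f n x) (f' x) < e / 2" "\<forall>\<^sub>F n in F. continuous_on {0..1} (f n)"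
      using assms unfolding unif_limit_def uniform_limit_iff by blast+
    then show "\<forall>\<^sub>F n in F. dist (L2_norm (\<lambda>x. f n x - f' x)) 0 < e"
    proof eventually_elim
      case (elim n)
      have "continuous_on {0..1} (\<lambda>x. f n x - f' x)"
        using elim assms by (intro continuous_intros) (auto simp: unif_limit_def)
      then have "L2_norm (\<lambda>x. f n x - f' x) \<le> e / 2"
        using elim by (intro L2_norm_le_bound continuous_on_borel_measurable_unit)
          (auto simp: dist_real_def intro: less_imp_le)
      then show ?case using e by simp
    qed
  qed
  then show ?thesis using assms in_L2 by (auto simp: unif_limit_def L2_limit_def elim: eventually_mono)
qed

lemma unif_limit_const: "continuous_on {0..1} g \<Longrightarrow> unif_limit (\<lambda>_. g) g F"
  by (simp add: unif_limit_def uniform_limit_const)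

lemma unif_limit_real:
  "(c \<longlongrightarrow> d) F \<Longrightarrow> unif_limit (\<lambda>n x. c n) (\<lambda>x. d) F"
  by (auto simp: unif_limit_def uniform_limit_iff tendsto_iff)

lemma unif_limit_add:
  assumes "unif_limit f f' F" "unif_limit g g' F"
  shows "unif_limit (\<lambda>n x. f n x + g n x) (\<lambda>x. f' x + g' x) F"
  unfolding unif_limit_def
proof (intro conjI)
  have "\<forall>\<^sub>F n in F. continuous_on {0..1} (f n)" "\<forall>\<^sub>F n in F. continuous_on {0..1} (g n)"
    using assms by (simp_all add: unif_limit_def)
  then show "\<forall>\<^sub>F n in F. continuous_on {0..1} (\<lambda>x. f n x + g n x)"
    by eventually_elim (intro continuous_intros)
qed (use assms in \<open>auto simp: unif_limit_def intro!: continuous_intros uniform_limit_add\<close>)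

lemma unif_limit_diff:
  assumes "unif_limit f f' F" "unif_limit g g' F"
  shows "unif_limit (\<lambda>n x. f n x - g n x) (\<lambda>x. f' x - g' x) F"
  unfolding unif_limit_def
proof (intro conjI)
  have "\<forall>\<^sub>F n in F. continuous_on {0..1} (f n)" "\<forall>\<^sub>F n in F. continuous_on {0..1} (g n)"
    using assms by (simp_all add: unif_limit_def)
  then show "\<forall>\<^sub>F n in F. continuous_on {0..1} (\<lambda>x. f n x - g n x)"
    by eventually_elim (intro continuous_intros)
qed (use assms in \<open>auto simp: unif_limit_def intro!: continuous_intros uniform_limit_minus\<close>)

lemma unif_limit_mult:
  assumes "unif_limit f f' F" "unif_limit g g' F"
  shows "unif_limit (\<lambda>n x. f n x * g n x) (\<lambda>x. f' x * g' x) F"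
proof -
  have "bounded (f' ` {0..1})" "bounded (g' ` {0..1})"
    using assms by (auto simp: unif_limit_def intro!: compact_imp_bounded compact_continuous_image)
  then have "uniform_limit {0..1} (\<lambda>n x. f n x * g n x) (\<lambda>x. f' x * g' x) F"
    using assms by (intro bounded_bilinear.bounded_uniform_limit[OF bounded_bilinear_mult])
      (auto simp: unif_limit_def)
  moreover have "\<forall>\<^sub>F n in F. continuous_on {0..1} (f n)" "\<forall>\<^sub>F n in F. continuous_on {0..1} (g n)"
    using assms by (simp_all add: unif_limit_def)
  then have "\<forall>\<^sub>F n in F. continuous_on {0..1} (\<lambda>x. f n x * g n x)"
    by eventually_elim (intro continuous_intros)
  ultimately show ?thesis using assms by (auto simp: unif_limit_def intro!: continuous_intros)
qed

lemma unif_limit_cmult: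
  "unif_limit f f' F \<Longrightarrow> unif_limit (\<lambda>n x. c * f n x) (\<lambda>x. c * f' x) F"
  by (rule unif_limit_mult[OF unif_limit_real]) auto

text \<open>Eventually all values of \<open>f n\<close> lie within distance 1 of those of
  \<open>f'\<close>, hence in one compact interval, on which \<open>h\<close> is uniformly
  continuous.\<close>

lemma unif_limit_compose:
  fixes h :: "real \<Rightarrow> real"
  assumes "unif_limit f f' F" "continuous_on UNIV h"
  shows "unif_limit (\<lambda>n x. h (f n x)) (\<lambda>x. h (f' x)) F"
proof -
  obtain B where B: "\<And>x. x \<in> {0..1} \<Longrightarrow> \<bar>f' x\<bar> \<le> B"
    using continuous_on_unit_bounded assms(1) by (auto simp: unif_limit_def)
  have uc: "uniformly_continuous_on {-B-1..B+1} h"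
    by (intro compact_uniformly_continuous continuous_on_subset[OF assms(2)]) auto
  have ev: "\<forall>\<^sub>F n in F. \<forall>x\<in>{0..1}. dist (f n x) (f' x) < 1"
    using assms(1) by (auto simp: unif_limit_def uniform_limit_iff)
  have "uniform_limit {0..1} (\<lambda>n x. h (f n x)) (\<lambda>x. h (f' x)) F"
    unfolding uniform_limit_iff
  proof safe
    fix e :: real assume "e > 0"
    then obtain d where d: "d > 0" "\<And>u v. u \<in> {-B-1..B+1} \<Longrightarrow> v \<in> {-B-1..B+1} \<Longrightarrow> dist v u < d \<Longrightarrow> dist (h v) (h u) < e"
      using uc unfolding uniformly_continuous_on_def by meson
    have "\<forall>\<^sub>F n in F. \<forall>x\<in>{0..1}. dist (f n x) (f' x) < d"
      using assms(1) d(1) by (auto simp: unif_limit_def uniform_limit_iff)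
    then show "\<forall>\<^sub>F n in F. \<forall>x\<in>{0..1}. dist (h (f n x)) (h (f' x)) < e"
      using ev
    proof eventually_elim
      case (elim n)
      show ?case
      proof
        fix x :: real assume x: "x \<in> {0..1}"
        have "\<bar>f n x - f' x\<bar> < 1" using elim x by (auto simp: dist_real_def)
        then show "dist (h (f n x)) (h (f' x)) < e"
          using elim x B[OF x] by (intro d(2)) auto
      qed
    qed
  qed
  moreover have "continuous_on {0..1} (\<lambda>x. h (k x))" if "continuous_on {0..1} k" for k
    using continuous_on_compose2[OF assms(2) that] by auto
  ultimately show ?thesis using assms(1) by (auto simp: unif_limit_def elim: eventually_mono)
qed

lemma L2_limit_mult:
  assumes h: "unif_limit h h' F" and f: "L2_limit f f' F"
  shows "L2_limit (\<lambda>n x. h n x * f n x) (\<lambda>x. h' x * f' x) F"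
proof -
  obtain B where B: "\<And>x. x \<in> {0..1} \<Longrightarrow> \<bar>h' x\<bar> \<le> B"
    using continuous_on_unit_bounded h by (auto simp: unif_limit_def)
  have B0: "B \<ge> 0" using B[of 0] by simp
  have bd: "\<exists>B. \<forall>x\<in>{0..1}. \<bar>k x\<bar> \<le> B" if "continuous_on {0..1} k" for k :: "real \<Rightarrow> real"
    using continuous_on_unit_bounded[OF that] by metis
  have prod_L2: "(\<lambda>x. k x * g x) \<in> L2" if "continuous_on {0..1} k" "g \<in> L2" for k g
    using bd[OF that(1)] L2_bounded_mult[OF that(2) continuous_on_borel_measurable_unit[OF that(1)]] by blast
  note h' = h[unfolded unif_limit_def] and f' = f[unfolded L2_limit_def]
  have "((\<lambda>n. L2_norm (\<lambda>x. h n x * f n x - h' x * f' x)) \<longlongrightarrow> 0) F"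
  proof (rule tendstoI)
    fix e :: real assume e: "e > 0"
    \<comment> \<open>The error splits as \<open>h n * (f n - f') + (h n - h') * f'\<close>. As
      \<open>d \<le> 1\<close>, \<open>B + 1\<close> bounds \<open>h n\<close>, so the error is at
      most \<open>d * (B + 1 + L2_norm f')\<close>; the spare 1 in the denominator makes the final
      inequality strict.\<close>
    define d where "d = min 1 (e / (B + 2 + L2_norm f'))"
    have d: "d > 0" "d \<le> 1" "d * (B + 2 + L2_norm f') \<le> e"
    proof -
      have "B + 2 + L2_norm f' > 0" using B0 L2_norm_nonneg[of f'] by linarith
      then show "d > 0" "d \<le> 1" "d * (B + 2 + L2_norm f') \<le> e"
        using e by (simp_all add: d_def min_def divide_le_eq mult_le_cancel_right1 pos_le_divide_eq)
    qed
    have "\<forall>\<^sub>F n in F. \<forall>x\<in>{0..1}. dist (h n x) (h' x) < d" using h' d(1) by (auto simp: uniform_limit_iff)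
    moreover have "\<forall>\<^sub>F n in F. continuous_on {0..1} (h n)" using h' by simp
    moreover have "\<forall>\<^sub>F n in F. f n \<in> L2" using f' by simp
    moreover have "\<forall>\<^sub>F n in F. dist (L2_norm (\<lambda>x. f n x - f' x)) 0 < d" using f' d(1) by (auto simp: tendsto_iff)
    ultimately show "\<forall>\<^sub>F n in F. dist (L2_norm (\<lambda>x. h n x * f n x - h' x * f' x)) 0 < e"
    proof eventually_elim
      case (elim n)
      have c: "continuous_on {0..1} (\<lambda>x. h n x - h' x)" using elim h' by (intro continuous_intros) auto
      have hb: "\<bar>h n x - h' x\<bar> \<le> d" if "x \<in> {0..1}" for x
        using elim that by (auto simp: dist_real_def intro: less_imp_le)
      have h1: "\<bar>h n x\<bar> \<le> B + 1" if "x \<in> {0..1}" for x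
        using hb[OF that] B[OF that] d(2) by linarith
      have "L2_norm (\<lambda>x. h n x * f n x - h' x * f' x)
          = L2_norm (\<lambda>x. h n x * (f n x - f' x) + (h n x - h' x) * f' x)"
        by (simp add: algebra_simps)
      also have "\<dots> \<le> L2_norm (\<lambda>x. h n x * (f n x - f' x)) + L2_norm (\<lambda>x. (h n x - h' x) * f' x)"
        using elim f' c by (intro L2_norm_triangle prod_L2 L2_diff) auto
      also have "\<dots> \<le> (B + 1) * L2_norm (\<lambda>x. f n x - f' x) + d * L2_norm f'"
        using elim f' c by (intro add_mono L2_norm_bounded_mult L2_diff continuous_on_borel_measurable_unit h1 hb) auto
      also have "\<dots> \<le> (B + 1) * d + d * L2_norm f'"
        using elim(4) B0 d(1) by (intro add_mono mult_left_mono) auto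
      also have "\<dots> < d * (B + 2 + L2_norm f')" using d(1) by (simp add: algebra_simps)
      finally show ?case using d(3) by simp
    qed
  qed
  moreover have "\<forall>\<^sub>F n in F. (\<lambda>x. h n x * f n x) \<in> L2"
    using h'[THEN conjunct2, THEN conjunct1] f'[THEN conjunct2, THEN conjunct1]
    by eventually_elim (rule prod_L2)
  ultimately show ?thesis using h' f' prod_L2 by (auto simp: L2_limit_def)
qed

text \<open>Cauchy-Schwarz on any \<open>A x\<close> is bounded by norms over the whole interval, so
  the error \<open>D n\<close> is free of \<open>x\<close>. This turns norm convergence into uniform
  convergence of indefinite integrals.\<close>

lemma integral_mult_L2_limit_uniform:
  assumes f: "L2_limit f f' F" and g: "L2_limit g g' F"
    and A: "\<And>x. x \<in> S \<Longrightarrow> A x \<in> sets lebesgue \<and> A x \<subseteq> {0..1}"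
  shows "uniform_limit S (\<lambda>n x. LINT y|lebesgue_on (A x). f n y * g n y)
      (\<lambda>x. LINT y|lebesgue_on (A x). f' y * g' y) F"
proof -
  note f' = f[unfolded L2_limit_def] and g' = g[unfolded L2_limit_def]
  define D where "D n = L2_norm (\<lambda>x. f n x - f' x) * L2_norm (\<lambda>x. g n x - g' x)
    + L2_norm (\<lambda>x. f n x - f' x) * L2_norm g' + L2_norm f' * L2_norm (\<lambda>x. g n x - g' x)" for n
  have "(D \<longlongrightarrow> 0 * 0 + 0 * L2_norm g' + L2_norm f' * 0) F"
    unfolding D_def using f' g' by (intro tendsto_intros) auto
  then have D: "(D \<longlongrightarrow> 0) F" by simp
  have key: "\<forall>\<^sub>F n in F. \<forall>x\<in>S. dist (LINT y|lebesgue_on (A x). f n y * g n y) (LINT y|lebesgue_on (A x). f' y * g' y) \<le> D n"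
    using f'[THEN conjunct2, THEN conjunct1] g'[THEN conjunct2, THEN conjunct1]
  proof eventually_elim
    case (elim n)
    show ?case
    proof
      fix x assume "x \<in> S"
      note A = A[OF this, THEN conjunct1] A[OF this, THEN conjunct2]
      let ?I = "\<lambda>h. LINT y|lebesgue_on (A x). h y"
      let ?df = "\<lambda>y. f n y - f' y" and ?dg = "\<lambda>y. g n y - g' y"
      have L: "?df \<in> L2" "?dg \<in> L2" "f' \<in> L2" "g' \<in> L2" using elim f' g' by (auto intro: L2_diff)
      have int: "integrable (lebesgue_on (A x)) (\<lambda>y. a y * b y)" if "a \<in> L2" "b \<in> L2" for a b
        using integrable_on_sub[OF L2_integrable_mult[OF that] A] .
      have "?I (\<lambda>y. f n y * g n y) = ?I (\<lambda>y. ?df y * ?dg y + ?df y * g' y + f' y * ?dg y + f' y * g' y)"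
        by (simp add: algebra_simps)
      also have "\<dots> = ?I (\<lambda>y. ?df y * ?dg y) + ?I (\<lambda>y. ?df y * g' y) + ?I (\<lambda>y. f' y * ?dg y) + ?I (\<lambda>y. f' y * g' y)"
        using int[OF L(1) L(2)] int[OF L(1) L(4)] int[OF L(3) L(2)] int[OF L(3) L(4)]
        by (simp only: Bochner_Integration.integral_add Bochner_Integration.integrable_add)
      finally have "?I (\<lambda>y. f n y * g n y) - ?I (\<lambda>y. f' y * g' y) =
        ?I (\<lambda>y. ?df y * ?dg y) + ?I (\<lambda>y. ?df y * g' y) + ?I (\<lambda>y. f' y * ?dg y)" by simp
      then show "dist (?I (\<lambda>y. f n y * g n y)) (?I (\<lambda>y. f' y * g' y)) \<le> D n"
        using L2_Cauchy_Schwarz_on[OF L(1) L(2) A] L2_Cauchy_Schwarz_on[OF L(1) L(4) A]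
          L2_Cauchy_Schwarz_on[OF L(3) L(2) A] unfolding dist_real_def D_def by linarith
    qed
  qed
  show ?thesis unfolding uniform_limit_iff
  proof safe
    fix e :: real assume "e > 0"
    then have "\<forall>\<^sub>F n in F. D n < e" using order_tendstoD(2)[OF D] by auto
    with key show "\<forall>\<^sub>F n in F. \<forall>x\<in>S. dist (LINT y|lebesgue_on (A x). f n y * g n y) (LINT y|lebesgue_on (A x). f' y * g' y) < e"
      by eventually_elim force
  qed
qed

lemma unif_limit_integral_from_0:
  assumes f: "L2_limit f f' F" and g: "L2_limit g g' F"
  shows "unif_limit (\<lambda>n x. LINT y|lebesgue_on {0..x}. f n y * g n y) (\<lambda>x. LINT y|lebesgue_on {0..x}. f' y * g' y) F"
  unfolding unif_limit_def
proof (intro conjI)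
  show "uniform_limit {0..1} (\<lambda>n x. LINT y|lebesgue_on {0..x}. f n y * g n y) (\<lambda>x. LINT y|lebesgue_on {0..x}. f' y * g' y) F"
    by (rule integral_mult_L2_limit_uniform[OF f g]) auto
  have "\<forall>\<^sub>F n in F. f n \<in> L2" "\<forall>\<^sub>F n in F. g n \<in> L2"
    using assms by (simp_all add: L2_limit_def)
  then show "\<forall>\<^sub>F n in F. continuous_on {0..1} (\<lambda>x. LINT y|lebesgue_on {0..x}. f n y * g n y)"
    by eventually_elim (intro continuous_on_integral_from_0 L2_integrable_mult)
qed (use assms in \<open>auto simp: L2_limit_def intro!: continuous_on_integral_from_0 L2_integrable_mult\<close>)

lemma unif_limit_integral_to_1:
  assumes f: "L2_limit f f' F" and g: "L2_limit g g' F"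
  shows "unif_limit (\<lambda>n x. LINT y|lebesgue_on {x..1}. f n y * g n y) (\<lambda>x. LINT y|lebesgue_on {x..1}. f' y * g' y) F"
  unfolding unif_limit_def
proof (intro conjI)
  show "uniform_limit {0..1} (\<lambda>n x. LINT y|lebesgue_on {x..1}. f n y * g n y) (\<lambda>x. LINT y|lebesgue_on {x..1}. f' y * g' y) F"
    by (rule integral_mult_L2_limit_uniform[OF f g]) auto
  have "\<forall>\<^sub>F n in F. f n \<in> L2" "\<forall>\<^sub>F n in F. g n \<in> L2"
    using assms by (simp_all add: L2_limit_def)
  then show "\<forall>\<^sub>F n in F. continuous_on {0..1} (\<lambda>x. LINT y|lebesgue_on {x..1}. f n y * g n y)"
    by eventually_elim (intro continuous_on_integral_to_1 L2_integrable_mult)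
qed (use assms in \<open>auto simp: L2_limit_def intro!: continuous_on_integral_to_1 L2_integrable_mult\<close>)

lemma tendsto_integral_mult:
  assumes f: "L2_limit f f' F" and g: "L2_limit g g' F"
  shows "((\<lambda>n. LINT y|unit_leb. f n y * g n y) \<longlongrightarrow> (LINT y|unit_leb. f' y * g' y)) F"
  using integral_mult_L2_limit_uniform[OF f g, of "{0::real}" "\<lambda>_. {0..1}"] by simp


section \<open>The acceleration as a function of position, velocity and second derivative\<close>

definition primitive :: "(real \<Rightarrow> real) \<Rightarrow> real \<Rightarrow> real" where
  "primitive f x = (LINT y|lebesgue_on {0..x}. f y)"

lemma eta_eq_exp_primitive: "eta q x = exp (primitive q x)"
  by (simp add: eta_def primitive_def)

lemma phi_eq_primitive: "phi q = primitive (eta q)"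
  by (simp add: phi_def primitive_def fun_eq_iff)

lemma eta_pos [simp]: "eta q x > 0" "eta q x \<noteq> 0"
  by (simp_all add: eta_def)

lemma continuous_on_primitive: "f \<in> L2 \<Longrightarrow> continuous_on {0..1} (primitive f)"
  unfolding primitive_def by (intro continuous_on_integral_from_0 L2_integrable)

lemma abs_primitive_le: "f \<in> L2 \<Longrightarrow> x \<in> {0..1} \<Longrightarrow> \<bar>primitive f x\<bar> \<le> L2_norm f"
  unfolding primitive_def by (intro L2_integral_on_bound) auto

lemma continuous_on_imp_L2: "continuous_on {0..1} f \<Longrightarrow> f \<in> L2"
  using unif_limit_imp_L2_limit[OF unif_limit_const] by (auto simp: L2_limit_def)

lemma continuous_on_eta: "q \<in> L2 \<Longrightarrow> continuous_on {0..1} (eta q)"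
  unfolding eta_eq_exp_primitive[abs_def] by (intro continuous_on_exp continuous_on_primitive)

lemma eta_in_L2: "q \<in> L2 \<Longrightarrow> eta q \<in> L2"
  by (rule continuous_on_imp_L2[OF continuous_on_eta])

lemma unif_limit_primitive:
  assumes "L2_limit f f' F"
  shows "unif_limit (\<lambda>n. primitive (f n)) (primitive f') F"
  using unif_limit_integral_from_0[OF assms L2_limit_const[of "\<lambda>_. 1"]]
  by (simp add: primitive_def[abs_def])

lemma unif_limit_eta:
  assumes "L2_limit q q' F"
  shows "unif_limit (\<lambda>n. eta (q n)) (eta q') F"
  unfolding eta_eq_exp_primitive[abs_def]
  by (intro unif_limit_compose[where h=exp] unif_limit_primitive assms continuous_intros)

lemma unif_limit_inverse_eta:
  assumes "L2_limit q q' F"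
  shows "unif_limit (\<lambda>n x. 1 / eta (q n) x) (\<lambda>x. 1 / eta q' x) F"
  using unif_limit_compose[OF unif_limit_primitive[OF assms], of "\<lambda>y. exp (- y)"]
  by (simp add: eta_eq_exp_primitive exp_minus inverse_eq_divide continuous_intros)

lemma unif_limit_phi:
  assumes "L2_limit q q' F"
  shows "unif_limit (\<lambda>n. phi (q n)) (phi q') F"
  unfolding phi_eq_primitive
  by (intro unif_limit_primitive unif_limit_imp_L2_limit unif_limit_eta assms)

text \<open>Continuity and bounds use the entries of the inverse matrix only as fixed numbers, so
  the inverse stays symbolic.\<close>

lemma H2_corr_vector:
  "H2_corr q (vector [a, b]) x =
     (matrix_inv H2_mat $ 1 $ 1 * a + matrix_inv H2_mat $ 1 $ 2 * b) * 1 +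
     (matrix_inv H2_mat $ 2 $ 1 * a + matrix_inv H2_mat $ 2 $ 2 * b) * phi q x"
  by (simp add: H2_corr_def inner_vec_def sum_2 matrix_vector_mult_def vector_2 mult.commute)

lemma unif_limit_H2_corr:
  assumes "L2_limit q q' F" "(a \<longlongrightarrow> a') F" "(b \<longlongrightarrow> b') F"
  shows "unif_limit (\<lambda>n. H2_corr (q n) (vector [a n, b n])) (H2_corr q' (vector [a', b'])) F"
  unfolding H2_corr_vector[abs_def]
  by (intro unif_limit_add unif_limit_mult unif_limit_real unif_limit_phi assms tendsto_intros)

lemma unif_limit_pi_star:
  assumes "L2_limit q q' F" "unif_limit u u' F"
  shows "unif_limit (\<lambda>n. pi_star (q n) (u n)) (pi_star q' u') F"
proof -
  have *: "((\<lambda>n. inner_eta (q n) (u n) (f n)) \<longlongrightarrow> inner_eta q' u' f') F" if "unif_limit f f' F" for f f'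
    unfolding inner_eta_def
    by (intro tendsto_integral_mult unif_limit_imp_L2_limit unif_limit_mult unif_limit_eta assms that)
  show ?thesis unfolding pi_star_def[abs_def]
    by (intro unif_limit_diff unif_limit_H2_corr * unif_limit_phi assms unif_limit_real tendsto_const)
qed

text \<open>This is \<open>U_fun\<close> of the square of \<open>p\<close> for
  \<open>p = v / eta q\<close>. The integrand is grouped as a product of two elements of L2, the
  shape that \<open>unif_limit_integral_to_1\<close> handles.\<close>

definition drift :: "(real \<Rightarrow> real) \<Rightarrow> (real \<Rightarrow> real) \<Rightarrow> real \<Rightarrow> real" where
  "drift q v x = 1/2 * (LINT y|lebesgue_on {x..1}. v y * (1 / eta q y * v y))"

text \<open>This is \<open>b_coeff\<close> after substituting \<open>phi q\<close> in both
  integrals: the inner one becomes \<open>primitive v x\<close>, and the outer one picks up the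
  Jacobian \<open>eta q x\<close>.\<close>

definition normal_coeff :: "(real \<Rightarrow> real) \<Rightarrow> (real \<Rightarrow> real) \<Rightarrow> real" where
  "normal_coeff q v = 3/2 * (LINT x|unit_leb. primitive v x * (primitive v x * eta q x))"

text \<open>The time derivative of \<open>v / eta q\<close>. As \<open>eta q\<close> is the
  exponential of \<open>primitive q\<close>, the derivative of its reciprocal is
  \<open>- primitive v / eta q\<close>.\<close>

definition momentum_deriv :: "(real \<Rightarrow> real) \<Rightarrow> (real \<Rightarrow> real) \<Rightarrow> (real \<Rightarrow> real) \<Rightarrow> real \<Rightarrow> real" where
  "momentum_deriv q v a x = 1 / eta q x * a x - primitive v x * (1 / eta q x * v x)"

text \<open>The covector \<open>cov_deriv_flat\<close> in terms of position, velocity and second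
  derivative; there the summands \<open>u\<close> and \<open>- (u - pi_star q u)\<close> collapse to
  \<open>pi_star q u\<close>.\<close>

definition cov_acc :: "(real \<Rightarrow> real) \<Rightarrow> (real \<Rightarrow> real) \<Rightarrow> (real \<Rightarrow> real) \<Rightarrow> real \<Rightarrow> real" where
  "cov_acc q v a x = momentum_deriv q v a x +
     (pi_star q (drift q v) x - H2_corr q (vector [0, normal_coeff q v]) x)"

lemma L2_limit_cov_acc:
  assumes q: "L2_limit q q' F" and v: "L2_limit v v' F" and a: "L2_limit a a' F"
  shows "L2_limit (\<lambda>n. cov_acc (q n) (v n) (a n)) (cov_acc q' v' a') F"
proof -
  note p = L2_limit_mult[OF unif_limit_inverse_eta[OF q] v]
  have drift: "unif_limit (\<lambda>n. drift (q n) (v n)) (drift q' v') F"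
    unfolding drift_def[abs_def] by (intro unif_limit_cmult unif_limit_integral_to_1 p v)
  have coeff: "((\<lambda>n. normal_coeff (q n) (v n)) \<longlongrightarrow> normal_coeff q' v') F"
    unfolding normal_coeff_def
    by (intro tendsto_mult tendsto_const tendsto_integral_mult unif_limit_imp_L2_limit
        unif_limit_mult unif_limit_primitive unif_limit_eta q v)
  show ?thesis unfolding cov_acc_def[abs_def] momentum_deriv_def
    by (intro L2_limit_add L2_limit_diff L2_limit_mult unif_limit_inverse_eta p q a v
        unif_limit_imp_L2_limit[OF unif_limit_diff] unif_limit_pi_star drift unif_limit_H2_corr
        coeff tendsto_const unif_limit_primitive)
qed

section \<open>Strong derivatives of curves in L2\<close>

lemma L2_limit_unique:
  assumes "L2_limit f g F" "L2_limit f h F" "F \<noteq> bot"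
  shows "AE x in unit_leb. g x = h x"
proof -
  have "L2_limit (\<lambda>n x. f n x - f n x) (\<lambda>x. g x - h x) F"
    using assms(1,2) by (rule L2_limit_diff)
  then have "((\<lambda>n. L2_norm (\<lambda>x. 0)) \<longlongrightarrow> L2_norm (\<lambda>x. g x - h x)) F"
    by (intro L2_limit_norm) simp
  then have "L2_norm (\<lambda>x. g x - h x) = 0"
    using tendsto_unique[OF assms(3) _ tendsto_const] by simp
  then have "AE x in unit_leb. g x - h x = 0"
    using assms by (intro L2_norm_eq_0_AE L2_diff) (auto simp: L2_limit_def)
  then show ?thesis by simp
qed

lemma eventually_within_unit: "\<forall>\<^sub>F s in at t within {0..1::real}. s \<in> {0..1} \<and> s \<noteq> t"
  by (auto simp: eventually_at_filter)

lemma at_within_unit_neq_bot: "t \<in> {0..1::real} \<Longrightarrow> at t within {0..1} \<noteq> bot"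
  using connected_imp_perfect[of "{0..1::real}" t] by (auto simp: trivial_limit_within)

lemma has_L2_deriv_iff_L2_limit:
  assumes "t \<in> {0..1}"
  shows "has_L2_deriv u w t \<longleftrightarrow> (\<forall>s\<in>{0..1}. u s \<in> L2) \<and>
    L2_limit (\<lambda>s x. (u s x - u t x) / (s - t)) w (at t within {0..1})"
proof -
  have "\<forall>\<^sub>F s in at t within {0..1}. (\<lambda>x. (u s x - u t x) / (s - t)) \<in> L2" if "\<forall>s\<in>{0..1}. u s \<in> L2"
    using eventually_within_unit[of t] by eventually_elim (use that assms in \<open>auto intro!: L2_divide L2_diff\<close>)
  then show ?thesis by (auto simp: has_L2_deriv_def L2_limit_def)
qed

lemma has_L2_deriv_unique:
  assumes "has_L2_deriv u v t" "has_L2_deriv u w t" "t \<in> {0..1}"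
  shows "AE x in unit_leb. v x = w x"
  using assms L2_limit_unique[OF _ _ at_within_unit_neq_bot]
  by (auto simp: has_L2_deriv_iff_L2_limit)

text \<open>Differentiability implies continuity: \<open>u s\<close> is \<open>u t\<close> plus the
  difference quotient times \<open>s - t\<close>, a uniform limit equal to 0.\<close>

lemma has_L2_deriv_imp_L2_limit:
  assumes "has_L2_deriv u w t" "t \<in> {0..1}"
  shows "L2_limit u (u t) (at t within {0..1})"
proof -
  have u: "\<forall>s\<in>{0..1}. u s \<in> L2" and
    lim: "L2_limit (\<lambda>s x. (u s x - u t x) / (s - t)) w (at t within {0..1})"
    using assms by (auto simp: has_L2_deriv_iff_L2_limit)
  have "((\<lambda>s. s - t) \<longlongrightarrow> t - t) (at t within {0..1})" by (intro tendsto_intros)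
  then have "unif_limit (\<lambda>s x. s - t) (\<lambda>x. 0) (at t within {0..1})" by (intro unif_limit_real) simp
  then have "L2_limit (\<lambda>s x. (s - t) * ((u s x - u t x) / (s - t)) + u t x) (\<lambda>x. 0 * w x + u t x) (at t within {0..1})"
    using u assms(2) by (intro L2_limit_add L2_limit_mult L2_limit_const lim) auto
  then have "L2_limit (\<lambda>s x. (s - t) * ((u s x - u t x) / (s - t)) + u t x) (u t) (at t within {0..1})" by simp
  then show ?thesis
  proof (rule L2_limit_cong_AE)
    show "\<forall>\<^sub>F s in at t within {0..1}. u s \<in> L2 \<and>
      (AE x in unit_leb. u s x = (s - t) * ((u s x - u t x) / (s - t)) + u t x)"
      using eventually_within_unit[of t] by eventually_elim (use u in auto)
  qed
qed

text \<open>Both \<open>p\<close> and the choices made by \<open>L2_deriv\<close> are known only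
  almost everywhere, with a null set that may vary with the time; norm derivatives do not see
  this.\<close>

lemma has_L2_deriv_cong_AE:
  assumes "has_L2_deriv u w t" "t \<in> {0..1}"
    and u': "\<And>s. s \<in> {0..1} \<Longrightarrow> u' s \<in> L2 \<and> (AE x in unit_leb. u' s x = u s x)"
  shows "has_L2_deriv u' w t"
proof -
  have "L2_limit (\<lambda>s x. (u' s x - u' t x) / (s - t)) w (at t within {0..1})"
  proof (rule L2_limit_cong_AE)
    show "L2_limit (\<lambda>s x. (u s x - u t x) / (s - t)) w (at t within {0..1})"
      using assms by (simp add: has_L2_deriv_iff_L2_limit)
    show "\<forall>\<^sub>F s in at t within {0..1}. (\<lambda>x. (u' s x - u' t x) / (s - t)) \<in> L2 \<and>
        (AE x in unit_leb. (u' s x - u' t x) / (s - t) = (u s x - u t x) / (s - t))"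
      using eventually_within_unit[of t]
    proof eventually_elim
      case (elim s)
      have "AE x in unit_leb. u' s x = u s x" "AE x in unit_leb. u' t x = u t x"
        using u' elim assms(2) by auto
      then have "AE x in unit_leb. (u' s x - u' t x) / (s - t) = (u s x - u t x) / (s - t)"
        by eventually_elim simp
      then show ?case using u' elim assms(2) by (auto intro!: L2_divide L2_diff)
    qed
  qed
  then show ?thesis using assms by (simp add: has_L2_deriv_iff_L2_limit)
qed

lemma has_L2_deriv_L2_deriv: "has_L2_deriv u w t \<Longrightarrow> has_L2_deriv u (L2_deriv u t) t"
  unfolding L2_deriv_def by (rule someI[of "\<lambda>v. has_L2_deriv u v t"])

text \<open>The difference quotient of \<open>exp (- y)\<close> with its removable singularity
  filled. Its continuity yields the uniform differentiability of \<open>1 / eta\<close> in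
  time.\<close>

lemma continuous_one_minus_exp_quotient:
  "continuous_on UNIV (\<lambda>y::real. if y = 0 then 1 else (1 - exp (- y)) / y)" (is "continuous_on _ ?\<psi>")
proof (intro continuous_at_imp_continuous_on ballI)
  fix y :: real
  show "isCont ?\<psi> y"
  proof (cases "y = 0")
    case True
    have "((\<lambda>y. - exp (- y)) has_real_derivative 1) (at 0)"
      by (auto intro!: derivative_eq_intros)
    then have "(\<lambda>h. (1 - exp (- h)) / h) \<midarrow>0\<rightarrow> (1::real)"
      by (simp add: DERIV_def)
    then have "?\<psi> \<midarrow>0\<rightarrow> (1::real)"
      by (rule Lim_transform_eventually) (auto simp: eventually_at_filter)
    then show ?thesis using True by (simp add: isCont_def)
  next
    case False
    then have "isCont (\<lambda>y. (1 - exp (- y)) / y) y" by (intro continuous_intros)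
    moreover have "\<forall>\<^sub>F z in nhds y. ?\<psi> z = (1 - exp (- z)) / z"
      using t1_space_nhds[OF False] by eventually_elim auto
    ultimately show ?thesis by (simp add: isCont_cong)
  qed
qed

text \<open>Let \<open>k\<close> be the primitive of the difference quotient of \<open>q\<close>.
  The quotient of \<open>1 / eta\<close> is exactly minus \<open>k / eta (q t)\<close> times the
  function of the preceding lemma at \<open>(s - t) * k\<close>. Now \<open>k\<close> tends
  uniformly to \<open>primitive v\<close>, so that argument tends uniformly to 0, where the function
  is 1.\<close>

lemma unif_limit_inverse_eta_quotient:
  assumes "has_L2_deriv q v t" "t \<in> {0..1}"
  shows "unif_limit (\<lambda>s x. (1 / eta (q s) x - 1 / eta (q t) x) / (s - t))
    (\<lambda>x. - (1 / eta (q t) x * primitive v x)) (at t within {0..1})"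
proof -
  let ?F = "at t within {0..1}"
  let ?\<psi> = "\<lambda>y::real. if y = 0 then 1 else (1 - exp (- y)) / y"
  let ?k = "\<lambda>s. primitive (\<lambda>x. (q s x - q t x) / (s - t))"
  have q: "\<forall>s\<in>{0..1}. q s \<in> L2" and
    lim: "L2_limit (\<lambda>s x. (q s x - q t x) / (s - t)) v ?F"
    using assms by (auto simp: has_L2_deriv_iff_L2_limit)
  have k: "unif_limit ?k (primitive v) ?F"
    using lim by (rule unif_limit_primitive)
  have "((\<lambda>s. s - t) \<longlongrightarrow> t - t) ?F" by (intro tendsto_intros)
  then have "unif_limit (\<lambda>s x. s - t) (\<lambda>x. 0) ?F" by (intro unif_limit_real) simp
  then have "unif_limit (\<lambda>s x. (s - t) * ?k s x) (\<lambda>x. 0 * primitive v x) ?F"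
    by (rule unif_limit_mult[OF _ k])
  then have psi: "unif_limit (\<lambda>s x. ?\<psi> ((s - t) * ?k s x)) (\<lambda>x. ?\<psi> (0 * primitive v x)) ?F"
    using continuous_one_minus_exp_quotient by (rule unif_limit_compose)
  have E: "unif_limit (\<lambda>s x. 1 / eta (q t) x) (\<lambda>x. 1 / eta (q t) x) ?F"
    using q assms(2) by (intro unif_limit_inverse_eta L2_limit_const) auto
  have lim: "unif_limit (\<lambda>s x. (-1) * (1 / eta (q t) x * (?k s x * ?\<psi> ((s - t) * ?k s x))))
      (\<lambda>x. (-1) * (1 / eta (q t) x * (primitive v x * ?\<psi> (0 * primitive v x)))) ?F"
    by (intro unif_limit_cmult unif_limit_mult E k psi)
  have eq: "(1 / eta (q s) x - 1 / eta (q t) x) / (s - t) =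
      (-1) * (1 / eta (q t) x * (?k s x * ?\<psi> ((s - t) * ?k s x)))"
    if "s \<in> {0..1}" "s \<noteq> t" "x \<in> {0..1}" for s x
  proof -
    have [simp]: "integrable (lebesgue_on {0..x}) (q s)" "integrable (lebesgue_on {0..x}) (q t)"
      using that assms(2) q by (auto intro!: integrable_on_sub L2_integrable)
    define k where "k = ?k s x"
    have k: "k = (primitive (q s) x - primitive (q t) x) / (s - t)"
      by (simp add: k_def primitive_def)
    then have "primitive (q s) x = primitive (q t) x + (s - t) * k"
      using that by (simp add: field_simps)
    then have "exp (- primitive (q s) x) = exp (- primitive (q t) x + - ((s - t) * k))"
      by simp
    then have E: "1 / eta (q s) x = 1 / eta (q t) x * exp (- ((s - t) * k))"
      unfolding exp_add by (simp add: eta_eq_exp_primitive exp_minus inverse_eq_divide)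
    show ?thesis
    proof (cases "k = 0")
      case True
      then show ?thesis using E unfolding k_def[symmetric] by simp
    next
      case False
      then show ?thesis using that E unfolding k_def[symmetric] by (simp add: field_simps)
    qed
  qed
  have "\<forall>\<^sub>F s in ?F. continuous_on {0..1} (\<lambda>x. (1 / eta (q s) x - 1 / eta (q t) x) / (s - t))"
    using eventually_within_unit[of t]
    by eventually_elim (use q assms(2) in \<open>auto intro!: continuous_intros continuous_on_eta\<close>)
  moreover have "uniform_limit {0..1} (\<lambda>s x. (1 / eta (q s) x - 1 / eta (q t) x) / (s - t))
    (\<lambda>x. - (1 / eta (q t) x * primitive v x)) ?F"
  proof -
    have "\<forall>\<^sub>F s in ?F. \<forall>x\<in>{0..1}. (1 / eta (q s) x - 1 / eta (q t) x) / (s - t) =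
      (-1) * (1 / eta (q t) x * (?k s x * ?\<psi> ((s - t) * ?k s x)))"
      using eventually_within_unit[of t] by eventually_elim (use eq in blast)
    then show ?thesis
      using lim unfolding unif_limit_def by (subst uniform_limit_cong) auto
  qed
  ultimately show ?thesis using lim by (auto simp: unif_limit_def)
qed

text \<open>The product rule, with the difference split so that each product has one uniformly
  convergent factor (built from \<open>1 / eta\<close>) and one factor converging in L2 (built from
  \<open>v\<close>).\<close>

lemma has_L2_deriv_momentum:
  assumes q: "has_L2_deriv q (v t) t" and v: "has_L2_deriv v a t" and t: "t \<in> {0..1}"
    and p: "\<And>s. s \<in> {0..1} \<Longrightarrow> p s \<in> L2 \<and> (AE x in unit_leb. p s x = v s x / eta (q s) x)"
  shows "has_L2_deriv p (momentum_deriv (q t) (v t) a) t"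
proof (rule has_L2_deriv_cong_AE[OF _ t])
  let ?F = "at t within {0..1}"
  let ?E = "\<lambda>s x. 1 / eta (q s) x"
  have vL: "\<forall>s\<in>{0..1}. v s \<in> L2" and v': "L2_limit (\<lambda>s x. (v s x - v t x) / (s - t)) a ?F"
    using v t by (auto simp: has_L2_deriv_iff_L2_limit)
  have "L2_limit (\<lambda>s x. ?E s x * ((v s x - v t x) / (s - t)) + (?E s x - ?E t x) / (s - t) * v t x)
      (\<lambda>x. ?E t x * a x + - (?E t x * primitive (v t) x) * v t x) ?F"
    using vL t by (intro L2_limit_add L2_limit_mult unif_limit_inverse_eta_quotient[OF q t] L2_limit_const
        unif_limit_inverse_eta v' has_L2_deriv_imp_L2_limit[OF q t]) auto
  moreover have "?E s x * ((v s x - v t x) / (s - t)) + (?E s x - ?E t x) / (s - t) * v t x =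
      (v s x / eta (q s) x - v t x / eta (q t) x) / (s - t)" for s x
    by (simp add: divide_inverse algebra_simps)
  moreover have "(\<lambda>x. ?E t x * a x + - (?E t x * primitive (v t) x) * v t x) = momentum_deriv (q t) (v t) a"
    by (simp add: momentum_deriv_def fun_eq_iff)
  moreover have "(\<lambda>x. v s x / eta (q s) x) \<in> L2" if "s \<in> {0..1}" for s
    using L2_limit_mult[OF unif_limit_inverse_eta[OF L2_limit_const] L2_limit_const, of "q s" "v s"]
      vL q that by (auto simp: has_L2_deriv_def L2_limit_def)
  ultimately show "has_L2_deriv (\<lambda>s x. v s x / eta (q s) x) (momentum_deriv (q t) (v t) a) t"
    using t by (simp add: has_L2_deriv_iff_L2_limit)
qed (use p in auto)


section \<open>The covariant derivative along a curve\<close>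

lemma phi_eq_integral:
  assumes "q \<in> L2" "x \<in> {0..1}"
  shows "phi q x = integral {0..x} (eta q)"
  unfolding phi_def using assms
  by (intro lebesgue_integral_eq_integral integrable_on_sub[OF L2_integrable[OF eta_in_L2]]) auto

lemma phi_has_real_derivative:
  assumes "q \<in> L2" "x \<in> {0..1}"
  shows "(phi q has_real_derivative eta q x) (at x within {0..1})"
proof -
  have "((\<lambda>x. integral {0..x} (eta q)) has_real_derivative eta q x) (at x within {0..1})"
    using assms by (intro integral_has_real_derivative continuous_on_eta)
  then show ?thesis
    by (rule has_field_derivative_transform_within[OF _ zero_less_one assms(2)])
      (simp add: phi_eq_integral[OF assms(1)])
qed

lemma phi_strict_mono_on:
  assumes "q \<in> L2"
  shows "strict_mono_on {0..1} (phi q)"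
proof (rule strict_mono_onI)
  fix x y :: real assume xy: "x \<in> {0..1}" "y \<in> {0..1}" "x < y"
  have sub: "{x..y} \<subseteq> {0..1}" using xy by auto
  show "phi q x < phi q y"
  proof (rule DERIV_pos_imp_increasing_open[OF xy(3)])
    fix z assume z: "x < z" "z < y"
    then have "(phi q has_real_derivative eta q z) (at z within {0..1})"
      using xy by (intro phi_has_real_derivative assms) auto
    then show "\<exists>d. (phi q has_real_derivative d) (at z) \<and> 0 < d"
      using z xy by (intro exI[of _ "eta q z"]) (simp add: at_within_Icc_at)
  next
    show "continuous_on {x..y} (phi q)"
      using continuous_on_subset[OF continuous_on_primitive[OF eta_in_L2[OF assms]] sub]
      by (simp add: phi_eq_primitive)
  qed
qed

lemma phi_inj_on: "q \<in> L2 \<Longrightarrow> inj_on (phi q) {0..1}"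
  using phi_strict_mono_on by (rule strict_mono_on_imp_inj_on)

lemma phi_image:
  assumes "q \<in> L2" "z \<in> {0..1}"
  shows "phi q ` {0..z} = {0..phi q z}"
proof
  have zero: "phi q 0 = 0" using phi_eq_integral[OF assms(1), of 0] by simp
  have mono: "phi q x \<le> phi q y" if "0 \<le> x" "x \<le> y" "y \<le> 1" for x y
    using strict_mono_on_leD[OF phi_strict_mono_on[OF assms(1)], of x y] that by auto
  show "phi q ` {0..z} \<subseteq> {0..phi q z}"
    using mono[of 0] mono[of _ z] assms(2) zero by auto
  have "continuous_on {0..z} (phi q)"
    using continuous_on_primitive[OF eta_in_L2[OF assms(1)]] assms(2)
    unfolding phi_eq_primitive by (rule_tac continuous_on_subset) auto
  then show "{0..phi q z} \<subseteq> phi q ` {0..z}"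
    using IVT'[of "phi q" 0 _ z] assms(2) zero by (fastforce simp: image_iff)
qed

text \<open>\<open>phi q\<close> is injective with derivative \<open>eta q\<close>. The change of
  variables theorem is an equivalence, so integrability passes from the composed function to
  \<open>f\<close>; this is how functions built from the inverse of \<open>phi\<close> become
  integrable.\<close>

lemma integral_phi_substitution:
  fixes f :: "real \<Rightarrow> real"
  assumes q: "q \<in> L2" and z: "z \<in> {0..1}"
    and int: "integrable (lebesgue_on {0..z}) (\<lambda>x. eta q x * f (phi q x))"
  shows "(LINT y|lebesgue_on {0..phi q z}. f y) = (LINT x|lebesgue_on {0..z}. eta q x * f (phi q x))"
proof -
  have conv: "g absolutely_integrable_on {0..c} \<longleftrightarrow> integrable (lebesgue_on {0..c}) g"
    for g :: "real \<Rightarrow> real" and c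
    by (simp add: set_integrable_def integrable_restrict_space)
  let ?I = "integral {0..z} (\<lambda>x. eta q x * f (phi q x))"
  have "(\<lambda>x. \<bar>eta q x\<bar> * f (phi q x)) absolutely_integrable_on {0..z} \<and>
      integral {0..z} (\<lambda>x. \<bar>eta q x\<bar> * f (phi q x)) = ?I
    \<longleftrightarrow> f absolutely_integrable_on (phi q ` {0..z}) \<and> integral (phi q ` {0..z}) f = ?I"
    by (rule has_absolute_integral_change_of_variables_1')
      (use z in \<open>auto intro!: DERIV_subset[OF phi_has_real_derivative[OF q]] inj_on_subset[OF phi_inj_on[OF q]]\<close>)
  then have "f absolutely_integrable_on {0..phi q z} \<and> integral {0..phi q z} f = ?I"
    using int by (simp add: conv phi_image[OF q z] abs_of_pos)
  then show ?thesis
    using int by (simp add: conv lebesgue_integral_eq_integral)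
qed

text \<open>Two substitutions: the inner integral up to \<open>phi q z\<close> becomes the integral
  of \<open>eta q * p = v\<close> up to \<open>z\<close>, then the outer integral is transformed
  with \<open>z = 1\<close>.\<close>

lemma b_coeff_eq_normal_coeff:
  assumes q: "q \<in> Q_mfd" and v: "v \<in> L2" and p: "p \<in> L2"
    and pv: "AE x in unit_leb. p x = v x / eta q x"
  shows "b_coeff p q = normal_coeff q v"
proof -
  have qL: "q \<in> L2" and phi1: "phi q 1 = 1" using q by (auto simp: Q_mfd_def phi_def)
  have eta_p: "(\<lambda>x. eta q x * p x) \<in> L2"
    using L2_limit_mult[OF unif_limit_eta[OF L2_limit_const[OF qL]] L2_limit_const[OF p], where F=sequentially]
    by (simp add: L2_limit_def)
  let ?i = "inv_into {0..1} (phi q)"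
  have inv: "?i (phi q x) = x" if "x \<in> {0..1}" for x
    using that phi_inj_on[OF qL] by (rule inv_into_f_f[rotated])
  have inner: "(LINT y|lebesgue_on {0..phi q z}. p (?i y)) = primitive v z" if z: "z \<in> {0..1}" for z
  proof -
    have cong: "eta q x * p (?i (phi q x)) = eta q x * p x" if "x \<in> {0..z}" for x
      using that z inv by auto
    have "integrable (lebesgue_on {0..z}) (\<lambda>x. eta q x * p (?i (phi q x)))"
      using integrable_on_sub[OF L2_integrable[OF eta_p], of "{0..z}"] z
      by (subst Bochner_Integration.integrable_cong[OF refl cong]) auto
    then have "(LINT y|lebesgue_on {0..phi q z}. p (?i y)) = (LINT x|lebesgue_on {0..z}. eta q x * p (?i (phi q x)))"
      by (rule integral_phi_substitution[OF qL z])
    also have "\<dots> = (LINT x|lebesgue_on {0..z}. eta q x * p x)"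
      by (rule Bochner_Integration.integral_cong[OF refl cong]) auto
    also have "\<dots> = (LINT x|lebesgue_on {0..z}. v x)"
    proof (rule integral_lebesgue_on_sub_cong_AE)
      show "AE x in unit_leb. eta q x * p x = v x" using pv by eventually_elim simp
    qed (use z L2_borel_measurable eta_p v in auto)
    finally show ?thesis by (simp add: primitive_def)
  qed
  let ?g = "\<lambda>x. (LINT y|lebesgue_on {0..x}. p (?i y))\<^sup>2"
  have cong: "eta q z * ?g (phi q z) = primitive v z * (primitive v z * eta q z)" if "z \<in> {0..1}" for z
    using inner[OF that] by (simp add: power2_eq_square)
  have "integrable unit_leb (\<lambda>z. primitive v z * (primitive v z * eta q z))"
    using continuous_on_primitive[OF v] continuous_on_eta[OF qL]
    by (intro L2_integrable continuous_on_imp_L2 continuous_on_mult)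
  then have "integrable unit_leb (\<lambda>z. eta q z * ?g (phi q z))"
    by (subst Bochner_Integration.integrable_cong[OF refl cong]) auto
  \<comment> \<open>The normalisation in \<open>Q_mfd\<close> gives \<open>phi q 1 = 1\<close>, so
    this is the integral over the whole unit interval.\<close>
  then have "(LINT x|lebesgue_on {0..phi q 1}. ?g x) = (LINT z|unit_leb. eta q z * ?g (phi q z))"
    by (intro integral_phi_substitution[OF qL]) auto
  also have "\<dots> = (LINT z|unit_leb. primitive v z * (primitive v z * eta q z))"
    by (rule Bochner_Integration.integral_cong[OF refl cong]) auto
  finally show ?thesis by (simp add: b_coeff_def normal_coeff_def phi1)
qed

lemma U_fun_eq_drift:
  assumes q: "q \<in> L2" and v: "v \<in> L2" and p: "p \<in> L2"
    and pv: "AE x in unit_leb. p x = v x / eta q x" and x: "x \<in> {0..1}"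
  shows "U_fun (\<lambda>y. (p y)\<^sup>2) q x = drift q v x"
proof -
  have [measurable]: "eta q \<in> borel_measurable unit_leb" "v \<in> borel_measurable unit_leb" "p \<in> borel_measurable unit_leb"
    using L2_borel_measurable eta_in_L2 q v p by auto
  have "(LINT y|lebesgue_on {x..1}. eta q y * (p y)\<^sup>2) = (LINT y|lebesgue_on {x..1}. v y * (1 / eta q y * v y))"
  proof (rule integral_lebesgue_on_sub_cong_AE)
    show "AE x in unit_leb. eta q x * (p x)\<^sup>2 = v x * (1 / eta q x * v x)"
      using pv by eventually_elim (simp add: power2_eq_square field_simps)
  qed (use x in auto)
  then show ?thesis by (simp add: U_fun_def drift_def)
qed

lemma pi_star_cong:
  assumes "\<And>x. x \<in> {0..1} \<Longrightarrow> u x = u' x" "x \<in> {0..1}"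
  shows "pi_star q u x = pi_star q u' x"
proof -
  have "inner_eta q u f = inner_eta q u' f" for f
    unfolding inner_eta_def using assms by (intro Bochner_Integration.integral_cong) auto
  then show ?thesis using assms by (simp add: pi_star_def)
qed

lemma cov_acc_in_L2:
  assumes "q \<in> L2" "v \<in> L2" "a \<in> L2"
  shows "cov_acc q v a \<in> L2"
  using L2_limit_cov_acc[OF assms[THEN L2_limit_const], where F=sequentially] by (simp add: L2_limit_def)

text \<open>All terms except \<open>L2_deriv p t\<close> agree at every point of the interval; that
  one is a choice of derivative and agrees with \<open>momentum_deriv\<close> almost everywhere by
  uniqueness.\<close>

lemma cov_deriv_flat_AE:
  assumes q: "has_L2_deriv q (v t) t" and v: "has_L2_deriv v a t" and t: "t \<in> {0..1}"
    and p: "\<And>s. s \<in> {0..1} \<Longrightarrow> p s \<in> L2 \<and> (AE x in unit_leb. p s x = v s x / eta (q s) x)"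
    and Q: "q t \<in> Q_mfd"
  shows "cov_deriv_flat p q t \<in> L2"
    and "AE x in unit_leb. cov_deriv_flat p q t x = cov_acc (q t) (v t) a x"
proof -
  have L: "q t \<in> L2" "v t \<in> L2" "a \<in> L2" "p t \<in> L2"
    using q v t p by (auto simp: has_L2_deriv_def)
  define R where "R x = pi_star (q t) (drift (q t) (v t)) x
    - H2_corr (q t) (vector [0, normal_coeff (q t) (v t)]) x" for x
  have eq: "cov_deriv_flat p q t x = L2_deriv p t x + R x" if "x \<in> {0..1}" for x
  proof -
    have "pi_star (q t) (U_fun (\<lambda>y. (p t y)\<^sup>2) (q t)) x = pi_star (q t) (drift (q t) (v t)) x"
      using L p[OF t] that by (intro pi_star_cong U_fun_eq_drift) auto
    then show ?thesis
      using b_coeff_eq_normal_coeff[OF Q L(2,4)] p[OF t] by (simp add: cov_deriv_flat_def Let_def R_def)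
  qed
  note deriv = has_L2_deriv_momentum[where q=q and v=v and p=p, OF q v t p]
  have "AE x in unit_leb. L2_deriv p t x = momentum_deriv (q t) (v t) a x"
    by (rule has_L2_deriv_unique[OF has_L2_deriv_L2_deriv[OF deriv] deriv t])
  then show "AE x in unit_leb. cov_deriv_flat p q t x = cov_acc (q t) (v t) a x"
    using AE_space by eventually_elim (simp add: eq cov_acc_def R_def)
  have "R = (\<lambda>x. cov_acc (q t) (v t) a x - momentum_deriv (q t) (v t) a x)"
    by (simp add: fun_eq_iff R_def cov_acc_def)
  then have "R \<in> L2"
    using cov_acc_in_L2[OF L(1-3)] deriv by (auto intro: L2_diff simp: has_L2_deriv_def)
  then have "(\<lambda>x. L2_deriv p t x + R x) \<in> L2"
    using has_L2_deriv_L2_deriv[OF deriv] by (intro L2_add) (auto simp: has_L2_deriv_def)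
  moreover have "(cov_deriv_flat p q t \<in> borel_measurable unit_leb) =
      ((\<lambda>x. L2_deriv p t x + R x) \<in> borel_measurable unit_leb)"
    by (rule measurable_cong) (simp add: eq)
  moreover have "integrable unit_leb (\<lambda>x. (cov_deriv_flat p q t x)\<^sup>2) =
      integrable unit_leb (\<lambda>x. (L2_deriv p t x + R x)\<^sup>2)"
    by (rule Bochner_Integration.integrable_cong) (auto simp: eq)
  ultimately show "cov_deriv_flat p q t \<in> L2" by (simp add: L2_def)
qed


section \<open>Lower bound for the functional\<close>

text \<open>Completing the square: \<open>y\<^sup>2 / (4 x)\<close> is the supremum of \<open>b y - b\<^sup>2 x\<close> over \<open>b\<close>.\<close>

lemma FR_integrand_ge: "ennreal (b * y - b\<^sup>2 * x) \<le> FR_integrand x y"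
proof (cases "x > 0")
  case True
  have "0 \<le> (y - 2 * b * x)\<^sup>2" by simp
  then have "4 * x * (b * y - b\<^sup>2 * x) \<le> y\<^sup>2"
    by (simp add: power2_eq_square algebra_simps)
  then have "b * y - b\<^sup>2 * x \<le> 1/4 * (y\<^sup>2 / x)"
    using True by (simp add: field_simps)
  then show ?thesis using True by (simp add: FR_integrand_def ennreal_leI)
next
  case False
  then show ?thesis by (auto simp: FR_integrand_def)
qed

lemma ennreal_integral_le_nn_integral:
  assumes "integrable M f"
  shows "ennreal (integral\<^sup>L M f) \<le> (\<integral>\<^sup>+x. ennreal (f x) \<partial>M)"
proof -
  have "ennreal (integral\<^sup>L M f) \<le> ennreal (LINT x|M. max 0 (f x))"
    using assms by (intro ennreal_leI integral_mono) auto
  also have "\<dots> = (\<integral>\<^sup>+x. ennreal (max 0 (f x)) \<partial>M)"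
    using assms by (intro nn_integral_eq_integral[symmetric]) auto
  also have "\<dots> = (\<integral>\<^sup>+x. ennreal (f x) \<partial>M)"
  proof (rule nn_integral_cong)
    fix x
    show "ennreal (max 0 (f x)) = ennreal (f x)"
      by (cases "0 \<le> f x") (simp_all add: max_def ennreal_neg)
  qed
  finally show ?thesis .
qed

text \<open>Boundedness of \<open>f\<close> makes it integrable against both parts of the pair, so
  the two Radon-Nikodym identities can be subtracted.\<close>

lemma signed_RN_integral:
  assumes l: "pos_measure l" and \<nu>: "signed_measure \<nu>" and d: "dominates l \<nu>"
    and f: "f \<in> borel_measurable square_borel" "\<And>z. z \<in> unit_square \<Longrightarrow> \<bar>f z\<bar> \<le> B"
  shows "integrable l (\<lambda>z. f z * signed_RN l \<nu> z)"
    and "(LINT z|l. f z * signed_RN l \<nu> z) = signed_integral \<nu> f"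
proof -
  have fin: "finite_measure l" and sets_l: "sets l = sets square_borel"
    using l by (auto simp: pos_measure_def)
  interpret finite_measure l by fact
  have *: "integrable l (\<lambda>z. enn2real (RN_deriv l N z) * f z) \<and>
      (LINT z|N. f z) = (LINT z|l. enn2real (RN_deriv l N z) * f z)"
    if N: "pos_measure N" "absolutely_continuous l N" for N
  proof -
    have N': "finite_measure N" "sets N = sets l" "sets N = sets square_borel"
      using N sets_l by (auto simp: pos_measure_def)
    have sf: "sigma_finite_measure N" using N'(1) by (simp add: finite_measure_def)
    have fl: "f \<in> borel_measurable l" "f \<in> borel_measurable N"
      using f(1) measurable_cong_sets[OF sets_l refl] measurable_cong_sets[OF N'(3) refl] by auto
    have "space N = unit_square"
      using sets_eq_imp_space_eq[OF N'(3)] by (simp add: space_restrict_space)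
    then have "integrable N f"
      using f(2) fl by (intro finite_measure.integrable_const_bound[OF N'(1), where B=B]) auto
    then show ?thesis
      using RN_deriv_integrable[OF sf N(2) N'(2) fl(1)] RN_deriv_integral[OF sf N(2) N'(2) fl(1)] by simp
  qed
  note 1 = *[of "fst \<nu>"] and 2 = *[of "snd \<nu>"]
  have eq: "f z * signed_RN l \<nu> z =
    enn2real (RN_deriv l (fst \<nu>) z) * f z - enn2real (RN_deriv l (snd \<nu>) z) * f z" for z
    by (simp add: signed_RN_def algebra_simps)
  show "integrable l (\<lambda>z. f z * signed_RN l \<nu> z)"
    unfolding eq using 1 2 \<nu> d by (auto simp: signed_measure_def dominates_def)
  show "(LINT z|l. f z * signed_RN l \<nu> z) = signed_integral \<nu> f"
    unfolding eq using 1 2 \<nu> d by (auto simp: signed_measure_def dominates_def signed_integral_def)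
qed

lemma pos_measure_null: "pos_measure (null_measure square_borel)"
  by (auto simp: pos_measure_def intro!: finite_measureI)

lemma time_derivativeD:
  assumes "time_derivative \<Delta> \<delta>" "continuous_on unit_square f" "continuous_on unit_square g"
    "\<And>t x. t \<in> {0..1} \<Longrightarrow> x \<in> {0..1} \<Longrightarrow> ((\<lambda>s. f (s, x)) has_real_derivative g (t, x)) (at t within {0..1})"
    "\<And>x. x \<in> {0..1} \<Longrightarrow> f (1, x) = 0"
  shows "(LINT z|\<Delta>. g z) + signed_integral \<delta> f = 0"
  using assms unfolding time_derivative_def by blast

text \<open>For every dominating \<open>l\<close>, \<open>FR_integrand_ge\<close> is integrated with
  the multiplier \<open>b\<close>, and the Radon-Nikodym integrals turn into integrals against the
  two measures. The weight \<open>f\<close> enters only through its pointwise lower bound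
  \<open>m\<close>.\<close>

lemma FR_ge_measure:
  assumes \<Delta>: "pos_measure \<Delta>" and td: "time_derivative \<Delta> \<delta>"
    and m: "0 \<le> m" "\<And>z. z \<in> unit_square \<Longrightarrow> m \<le> f z"
  shows "ennreal (m / 4 * measure \<Delta> unit_square) \<le> FR f (of_pos \<Delta>) \<delta>"
  unfolding FR_def
proof (rule INF_greatest)
  fix l assume "l \<in> {l. pos_measure l \<and> dominates l (of_pos \<Delta>) \<and> dominates l \<delta>}"
  then have l: "pos_measure l" "dominates l (of_pos \<Delta>)" "dominates l \<delta>" by auto
  \<comment> \<open>For multipliers \<open>c * (1 - t)\<close> the guaranteed gain per unit of mass
    is \<open>c - c\<^sup>2\<close>, which is largest at \<open>c = 1/2\<close>.\<close>
  define b :: "real \<times> real \<Rightarrow> real" where "b z = (1 - fst z) / 2" for z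
  let ?X = "signed_RN l (of_pos \<Delta>)" and ?Y = "signed_RN l \<delta>"
  define g where "g z = b z * ?Y z - (b z)\<^sup>2 * ?X z" for z
  have cont: "continuous_on A b" for A
    unfolding b_def by (intro continuous_intros) auto
  have meas: "b \<in> borel_measurable square_borel" "(\<lambda>z. (b z)\<^sup>2) \<in> borel_measurable square_borel"
    using cont by (auto intro!: borel_measurable_continuous_on_restrict continuous_intros)
  have b: "0 \<le> b z" "b z \<le> 1/2" if "z \<in> unit_square" for z
    using that by (auto simp: b_def)
  have b2: "(b z)\<^sup>2 \<le> 1/4" if "z \<in> unit_square" for z
    using power_mono[OF b(2) b(1), of z 2] that by (auto simp: power2_eq_square)
  have sm: "signed_measure \<delta>" "signed_measure (of_pos \<Delta>)"
    using td \<Delta> pos_measure_null by (auto simp: time_derivative_def signed_measure_def of_pos_def)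
  note Y = signed_RN_integral[OF l(1) sm(1) l(3) meas(1), of "1/2"]
  note X = signed_RN_integral[OF l(1) sm(2) l(2) meas(2), of "1/4"]
  have int: "integrable l g"
    unfolding g_def using b b2 by (intro Bochner_Integration.integrable_diff X Y) auto
  have fin: "finite_measure \<Delta>" and sets_\<Delta>: "sets \<Delta> = sets square_borel"
    using \<Delta> by (auto simp: pos_measure_def)
  have space_\<Delta>: "space \<Delta> = unit_square"
    using sets_eq_imp_space_eq[OF sets_\<Delta>] by (simp add: space_restrict_space)
  have meas_\<Delta>: "(\<lambda>z. (b z)\<^sup>2) \<in> borel_measurable \<Delta>"
    using meas(2) by (simp only: measurable_cong_sets[OF sets_\<Delta> refl])
  \<comment> \<open>An admissible test function, since \<open>b\<close> vanishes at time 1. Its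
    value at time 0 is not zero, but the weak identity has no boundary term there because it
    contains the initial condition.\<close>
  have "(LINT z|\<Delta>. - (1/2)) + signed_integral \<delta> b = 0"
    by (rule time_derivativeD[OF td cont]) (auto simp: b_def intro!: derivative_eq_intros)
  then have sb: "signed_integral \<delta> b = measure \<Delta> unit_square / 2"
    using space_\<Delta> by simp
  have "(LINT z|\<Delta>. (b z)\<^sup>2) \<le> (LINT z|\<Delta>. 1/4)"
    using b2 space_\<Delta> meas_\<Delta>
    by (intro integral_mono finite_measure.integrable_const_bound[OF fin, where B="1/4"]
        finite_measure.integrable_const[OF fin]) auto
  then have "(LINT z|\<Delta>. (b z)\<^sup>2) \<le> measure \<Delta> unit_square / 4" using space_\<Delta> by simp
  moreover have "integral\<^sup>L l g = signed_integral \<delta> b - signed_integral (of_pos \<Delta>) (\<lambda>z. (b z)\<^sup>2)"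
    unfolding g_def using b b2 X Y by (subst Bochner_Integration.integral_diff) auto
  moreover have "signed_integral (of_pos \<Delta>) (\<lambda>z. (b z)\<^sup>2) = (LINT z|\<Delta>. (b z)\<^sup>2)"
    by (simp add: signed_integral_def of_pos_def)
  ultimately have "measure \<Delta> unit_square / 4 \<le> integral\<^sup>L l g" using sb by simp
  then have "ennreal (m / 4 * measure \<Delta> unit_square) \<le> ennreal (LINT z|l. m * g z)"
    using m(1) mult_left_mono[of "measure \<Delta> unit_square / 4" "integral\<^sup>L l g" m]
    by (intro ennreal_leI) simp
  also have "\<dots> \<le> (\<integral>\<^sup>+z. ennreal (m * g z) \<partial>l)"
    using int by (intro ennreal_integral_le_nn_integral) simp
  also have "\<dots> \<le> (\<integral>\<^sup>+z. FR_integrand (?X z) (?Y z) * ennreal (f z) \<partial>l)"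
  proof (rule nn_integral_mono)
    fix z assume "z \<in> space l"
    then have z: "z \<in> unit_square"
      using l(1) sets_eq_imp_space_eq[of l square_borel] by (simp add: pos_measure_def space_restrict_space)
    \<comment> \<open>\<open>ennreal\<close> truncates negative values of \<open>g z\<close> to 0,
      so after factoring out \<open>m\<close> both factors can be compared separately.\<close>
    have "ennreal (m * g z) = ennreal (g z) * ennreal m"
      using m(1) by (simp add: ennreal_mult' mult.commute)
    also have "\<dots> \<le> FR_integrand (?X z) (?Y z) * ennreal (f z)"
      unfolding g_def using m(2)[OF z] by (intro mult_mono FR_integrand_ge ennreal_leI) auto
    finally show "ennreal (m * g z) \<le> FR_integrand (?X z) (?Y z) * ennreal (f z)" .
  qed
  finally show "ennreal (m / 4 * measure \<Delta> unit_square)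
    \<le> (\<integral>\<^sup>+z. FR_integrand (?X z) (?Y z) * ennreal (f z) \<partial>l)" .
qed

text \<open>Subadditivity for a possibly non-measurable \<open>f\<close>: the integral is a supremum
  over simple functions \<open>s\<close> below \<open>f + g\<close>, and \<open>s - g\<close> is
  measurable and below \<open>f\<close>. Finiteness of \<open>g\<close> matters because
  \<open>top - top = top\<close> in \<open>ennreal\<close>.\<close>

lemma nn_integral_add_le:
  assumes g: "g \<in> borel_measurable M" "\<And>x. x \<in> space M \<Longrightarrow> g x \<noteq> \<infinity>"
  shows "(\<integral>\<^sup>+x. f x + g x \<partial>M) \<le> (\<integral>\<^sup>+x. f x \<partial>M) + (\<integral>\<^sup>+x. g x \<partial>M)"
  unfolding nn_integral_def[of M "\<lambda>x. f x + g x"]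
proof (rule SUP_least)
  fix s assume "s \<in> {s. simple_function M s \<and> s \<le> (\<lambda>x. f x + g x)}"
  then have s: "simple_function M s" "\<And>x. s x \<le> f x + g x" by (auto simp: le_fun_def)
  have [measurable]: "s \<in> borel_measurable M" using s(1) by (rule borel_measurable_simple_function)
  have "integral\<^sup>S M s = (\<integral>\<^sup>+x. s x \<partial>M)" using s(1) by (simp add: nn_integral_eq_simple_integral)
  also have "\<dots> \<le> (\<integral>\<^sup>+x. (s x - g x) + g x \<partial>M)"
  proof (rule nn_integral_mono)
    fix x
    show "s x \<le> s x - g x + g x"
      by (cases "g x \<le> s x") (auto simp: diff_add_self_ennreal)
  qed
  also have "\<dots> = (\<integral>\<^sup>+x. s x - g x \<partial>M) + (\<integral>\<^sup>+x. g x \<partial>M)"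
    using g(1) by (intro nn_integral_add) auto
  also have "\<dots> \<le> (\<integral>\<^sup>+x. f x \<partial>M) + (\<integral>\<^sup>+x. g x \<partial>M)"
  proof (intro add_right_mono nn_integral_mono)
    fix x assume "x \<in> space M"
    then show "s x - g x \<le> f x"
      using s(2)[of x] g(2)[of x] by (simp add: ennreal_minus_le_iff add.commute)
  qed
  finally show "integral\<^sup>S M s \<le> (\<integral>\<^sup>+x. f x \<partial>M) + (\<integral>\<^sup>+x. g x \<partial>M)" .
qed

section \<open>Effect of the measure on the squared norm of the acceleration\<close>

lemma norm_sq_at_nonneg: "0 \<le> norm_sq_at q p"
  unfolding norm_sq_at_def by (intro integral_nonneg_AE AE_I2) (simp add: less_imp_le)

text \<open>On expanding the square, the term quadratic in \<open>B\<close> is nonnegative and is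
  dropped; Cauchy-Schwarz bounds the cross term, as \<open>eta q * B\<close> is at most
  \<open>M * \<beta>\<close> in absolute value.\<close>

lemma norm_sq_at_perturb:
  assumes q: "q \<in> L2" and M: "\<And>x. x \<in> {0..1} \<Longrightarrow> eta q x \<le> M"
    and A: "A \<in> L2" and B: "B \<in> borel_measurable unit_leb" "\<And>x. x \<in> {0..1} \<Longrightarrow> \<bar>B x\<bar> \<le> \<beta>"
  shows "norm_sq_at q A \<le> norm_sq_at q (\<lambda>x. A x + B x) + 2 * (M * \<beta> * L2_norm A)"
proof -
  have BL: "B \<in> L2" using B by (rule L2_bounded)
  have abs_eta: "\<bar>eta q x\<bar> \<le> M" if "x \<in> {0..1}" for x
    using M[OF that] eta_pos(1)[of q x] by linarith
  have eta_meas: "eta q \<in> borel_measurable unit_leb"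
    by (intro L2_borel_measurable eta_in_L2 q)
  have eL: "(\<lambda>x. eta q x * h x) \<in> L2" if "h \<in> L2" for h
    using that eta_meas abs_eta by (rule L2_bounded_mult)
  have M0: "0 \<le> M" using abs_eta[of 0] by simp
  have int: "integrable unit_leb (\<lambda>x. eta q x * (h x * k x))" if "h \<in> L2" "k \<in> L2" for h k
    using L2_integrable_mult[OF eL[OF that(1)] that(2)] by (simp add: mult.assoc)
  have "\<bar>LINT x|unit_leb. (eta q x * B x) * A x\<bar> \<le> L2_norm (\<lambda>x. eta q x * B x) * L2_norm A"
    by (intro L2_Cauchy_Schwarz eL BL A)
  also have "\<dots> \<le> M * \<beta> * L2_norm A"
    using M0 eL[OF BL] abs_eta B(2)
    by (intro mult_right_mono L2_norm_le_bound) (auto simp: abs_mult L2_def intro!: mult_mono)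
  finally have 1: "- (LINT x|unit_leb. eta q x * (A x * B x)) \<le> M * \<beta> * L2_norm A"
    by (simp add: ac_simps)
  have "(LINT x|unit_leb. eta q x * (A x * A x) + 2 * (eta q x * (A x * B x)))
      \<le> (LINT x|unit_leb. eta q x * ((A x + B x) * (A x + B x)))"
  proof (intro integral_mono Bochner_Integration.integrable_add int A BL integrable_mult_right L2_add)
    fix x
    have "0 \<le> eta q x * (B x * B x)" by (simp add: less_imp_le)
    then show "eta q x * (A x * A x) + 2 * (eta q x * (A x * B x)) \<le> eta q x * ((A x + B x) * (A x + B x))"
      by (simp add: algebra_simps)
  qed
  then have "(LINT x|unit_leb. eta q x * (A x * A x)) + 2 * (LINT x|unit_leb. eta q x * (A x * B x))
      \<le> (LINT x|unit_leb. eta q x * ((A x + B x) * (A x + B x)))"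
    using int[OF A A] int[OF A BL] by simp
  then show ?thesis using 1 by (simp add: norm_sq_at_def power2_eq_square)
qed

definition H2_inv_norm :: real where
  "H2_inv_norm = \<bar>matrix_inv H2_mat $ 1 $ 1\<bar> + \<bar>matrix_inv H2_mat $ 1 $ 2\<bar>
     + \<bar>matrix_inv H2_mat $ 2 $ 1\<bar> + \<bar>matrix_inv H2_mat $ 2 $ 2\<bar>"

lemma abs_H2_corr_le:
  assumes "\<bar>a\<bar> \<le> c" "\<bar>b\<bar> \<le> c" "\<bar>phi q x\<bar> \<le> M" "1 \<le> M"
  shows "\<bar>H2_corr q (vector [a, b]) x\<bar> \<le> H2_inv_norm * (c * M)"
proof -
  have bd: "\<bar>n * d * f\<bar> \<le> \<bar>n\<bar> * (c * M)" if "\<bar>d\<bar> \<le> c" "\<bar>f\<bar> \<le> M" for n d f :: real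
    unfolding abs_mult mult.assoc using that by (intro mult_left_mono mult_mono) auto
  let ?N = "matrix_inv H2_mat"
  have "H2_corr q (vector [a, b]) x = ?N $ 1 $ 1 * a * 1 + ?N $ 1 $ 2 * b * 1
      + ?N $ 2 $ 1 * a * phi q x + ?N $ 2 $ 2 * b * phi q x"
    by (simp add: H2_corr_vector algebra_simps)
  also have "\<bar>\<dots>\<bar> \<le> \<bar>?N $ 1 $ 1\<bar> * (c * M) + \<bar>?N $ 1 $ 2\<bar> * (c * M) + \<bar>?N $ 2 $ 1\<bar> * (c * M) + \<bar>?N $ 2 $ 2\<bar> * (c * M)"
    by (intro order_trans[OF abs_triangle_ineq] add_mono bd) (use assms in auto)
  finally show ?thesis by (simp add: H2_inv_norm_def algebra_simps)
qed

lemma U_meas_bounds: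
  assumes q: "q \<in> L2" and M: "\<And>x. x \<in> {0..1} \<Longrightarrow> eta q x \<le> M"
    and m: "finite_measure m" "sets m = sets (restrict_space borel {0..1})"
  shows "U_meas m q \<in> borel_measurable unit_leb"
    and "x \<in> {0..1} \<Longrightarrow> \<bar>U_meas m q x\<bar> \<le> 1/2 * (M * measure m {0..1})"
proof -
  interpret finite_measure m by fact
  have space_m: "space m = {0..1}"
    using sets_eq_imp_space_eq[OF m(2)] by (simp add: space_restrict_space)
  have eta_meas: "eta q \<in> borel_measurable m"
    using continuous_on_eta[OF q] measurable_cong_sets[OF m(2) refl]
    by (auto intro: borel_measurable_continuous_on_restrict)
  have Ivl: "{x..1} \<in> sets m" if "x \<in> {0..1}" for x :: real
    using that by (auto simp: m(2) sets_restrict_space image_iff intro!: bexI[of _ "{x..1}"])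
  have int: "integrable m (\<lambda>y. indicator {x..1} y * eta q y)" if "x \<in> {0..1}" for x
  proof (rule integrable_const_bound[where B=M])
    show "AE y in m. norm (indicator {x..1} y * eta q y) \<le> M"
      using M eta_pos(1)[of q] space_m that less_le_trans[OF eta_pos(1) M[OF that]]
      by (intro AE_I2) (auto simp: indicator_def less_imp_le)
  qed (use Ivl[OF that] eta_meas in auto)
  have U: "U_meas m q x = 1/2 * (LINT y|m. indicator {x..1} y * eta q y)" for x
    by (simp add: U_meas_def set_lebesgue_integral_def)
  \<comment> \<open>The interval \<open>{x..1}\<close> shrinks as \<open>x\<close> grows and
    \<open>eta\<close> is positive, so monotonicity supplies measurability in
    \<open>x\<close>.\<close>
  have "mono_on {0..1} (\<lambda>x. - U_meas m q x)"
  proof (rule mono_onI)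
    fix x y :: real assume xy: "x \<in> {0..1}" "y \<in> {0..1}" "x \<le> y"
    have "(LINT z|m. indicator {y..1} z * eta q z) \<le> (LINT z|m. indicator {x..1} z * eta q z)"
      using xy by (intro integral_mono int) (auto simp: indicator_def less_imp_le)
    then show "- U_meas m q x \<le> - U_meas m q y" by (simp add: U)
  qed
  then have "(\<lambda>x. - U_meas m q x) \<in> borel_measurable (restrict_space borel {0..1})"
    by (rule borel_measurable_mono_on_fnc)
  then have "(\<lambda>x. - U_meas m q x) \<in> borel_measurable unit_leb"
    by (metis borel_measurable_subalgebra mono_restrict_space space_lborel space_restrict_space
        sets_completionI_sets sets_lborel subsetI space_completion space_borel)
  then show "U_meas m q \<in> borel_measurable unit_leb"
    using borel_measurable_uminus[of "\<lambda>x. - U_meas m q x" unit_leb] by simp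
  show "\<bar>U_meas m q x\<bar> \<le> 1/2 * (M * measure m {0..1})" if x: "x \<in> {0..1}"
  proof -
    have "0 \<le> (LINT y|m. indicator {x..1} y * eta q y)"
      by (intro integral_nonneg_AE AE_I2) (simp add: less_imp_le)
    moreover have "(LINT y|m. indicator {x..1} y * eta q y) \<le> (LINT y|m. M)"
      using M space_m less_le_trans[OF eta_pos(1) M[OF x]] x
      by (intro integral_mono int integrable_const) (auto simp: indicator_def less_imp_le)
    ultimately show ?thesis using space_m by (simp add: U mult.commute)
  qed
qed

text \<open>The four factors \<open>M\<close> come from \<open>eta\<close> inside
  \<open>U_meas\<close>, \<open>eta\<close> in the inner product, the function paired with it, and
  \<open>phi\<close> in the correction. The assumption \<open>1 \<le> M\<close> covers the constant
  function 1 and lets \<open>M ^ 4\<close> absorb the lower power.\<close>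

lemma pi_star_U_meas_bounds:
  assumes q: "q \<in> L2" and M: "1 \<le> M" "\<And>x. x \<in> {0..1} \<Longrightarrow> eta q x \<le> M"
    and m: "finite_measure m" "sets m = sets (restrict_space borel {0..1})"
  shows "pi_star q (U_meas m q) \<in> borel_measurable unit_leb"
    and "x \<in> {0..1} \<Longrightarrow> \<bar>pi_star q (U_meas m q) x\<bar> \<le> (1 + H2_inv_norm) * M ^ 4 * measure m {0..1}"
proof -
  have U: "U_meas m q \<in> borel_measurable unit_leb"
    "\<And>x. x \<in> {0..1} \<Longrightarrow> \<bar>U_meas m q x\<bar> \<le> 1/2 * (M * measure m {0..1})"
    using U_meas_bounds[OF q _ m] M(2) by blast+
  have phi_cont: "continuous_on {0..1} (phi q)"
    unfolding phi_eq_primitive by (intro continuous_on_primitive eta_in_L2 q)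
  show "pi_star q (U_meas m q) \<in> borel_measurable unit_leb"
    unfolding pi_star_def[abs_def] H2_corr_vector
    using U(1) continuous_on_borel_measurable_unit[OF phi_cont] by simp
  have eta_meas: "eta q \<in> borel_measurable unit_leb" by (intro L2_borel_measurable eta_in_L2 q)
  have abs_eta: "\<bar>eta q x\<bar> \<le> M" if "x \<in> {0..1}" for x
    using M(2)[OF that] eta_pos(1)[of q x] by linarith
  have phi_le: "\<bar>phi q x\<bar> \<le> M" if "x \<in> {0..1}" for x
    using abs_primitive_le[OF eta_in_L2[OF q] that] L2_norm_le_bound[OF eta_meas abs_eta]
    by (simp add: phi_eq_primitive)
  define \<kappa> where "\<kappa> = measure m {0..1}"
  have \<kappa>0: "0 \<le> \<kappa>" by (simp add: \<kappa>_def)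
  have inner: "\<bar>inner_eta q (U_meas m q) f\<bar> \<le> 1/2 * (M * \<kappa>) * M * M"
    if f: "f \<in> borel_measurable unit_leb" "\<And>x. x \<in> {0..1} \<Longrightarrow> \<bar>f x\<bar> \<le> M" for f
  proof -
    have bd: "\<bar>U_meas m q x * f x * eta q x\<bar> \<le> 1/2 * (M * \<kappa>) * M * M" if x: "x \<in> {0..1}" for x
      unfolding abs_mult using U(2)[OF x] f(2)[OF x] abs_eta[OF x] M(1) \<kappa>0
      by (intro mult_mono) (simp_all add: \<kappa>_def)
    have meas: "(\<lambda>x. U_meas m q x * f x * eta q x) \<in> borel_measurable unit_leb"
      using U(1) f(1) eta_meas by simp
    have "\<bar>LINT x|unit_leb. U_meas m q x * f x * eta q x\<bar> \<le> L2_norm (\<lambda>x. U_meas m q x * f x * eta q x)"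
      by (rule L2_integral_on_bound[where A="{0..1}", OF L2_bounded[OF meas bd]]) auto
    also have "\<dots> \<le> 1/2 * (M * \<kappa>) * M * M"
      using meas bd by (rule L2_norm_le_bound)
    finally show ?thesis by (simp add: inner_eta_def)
  qed
  show "\<bar>pi_star q (U_meas m q) x\<bar> \<le> (1 + H2_inv_norm) * M ^ 4 * measure m {0..1}" if x: "x \<in> {0..1}"
  proof -
    have N0: "0 \<le> H2_inv_norm" by (simp add: H2_inv_norm_def)
    have "\<bar>H2_corr q (vector [inner_eta q (U_meas m q) (\<lambda>_. 1), inner_eta q (U_meas m q) (phi q)]) x\<bar>
        \<le> H2_inv_norm * (1/2 * (M * \<kappa>) * M * M * M)"
      using M(1) phi_le x continuous_on_borel_measurable_unit[OF phi_cont]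
      by (intro abs_H2_corr_le inner) auto
    moreover have "\<bar>U_meas m q x\<bar> \<le> 1/2 * (M * \<kappa>)" using U(2)[OF x] by (simp add: \<kappa>_def)
    ultimately have "\<bar>pi_star q (U_meas m q) x\<bar> \<le> 1/2 * (M * \<kappa>) + H2_inv_norm * (1/2 * (M * \<kappa>) * M * M * M)"
      unfolding pi_star_def by linarith
    also have "\<dots> = 1/2 * (M * \<kappa>) + 1/2 * (H2_inv_norm * (M ^ 4 * \<kappa>))"
      by (simp add: power4_eq_xxxx)
    also have "\<dots> \<le> M ^ 4 * \<kappa> + H2_inv_norm * (M ^ 4 * \<kappa>)"
    proof (rule add_mono)
      have "M * \<kappa> \<le> M ^ 4 * \<kappa>" using M(1) \<kappa>0 power_increasing[of 1 4 M] by (intro mult_right_mono) auto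
      moreover have "0 \<le> M * \<kappa>" using M(1) \<kappa>0 by simp
      ultimately show "1/2 * (M * \<kappa>) \<le> M ^ 4 * \<kappa>" by linarith
      have "0 \<le> H2_inv_norm * (M ^ 4 * \<kappa>)" using N0 M(1) \<kappa>0 by simp
      then show "1/2 * (H2_inv_norm * (M ^ 4 * \<kappa>)) \<le> H2_inv_norm * (M ^ 4 * \<kappa>)" by linarith
    qed
    finally show ?thesis by (simp add: \<kappa>_def algebra_simps)
  qed
qed

section \<open>The functional at the zero measure\<close>

lemma FR_null: "FR f (of_pos (null_measure square_borel)) (of_pos (null_measure square_borel)) = 0"
proof -
  \<comment> \<open>The zero measure dominates itself, so it may serve as \<open>l\<close> in the
    infimum.\<close>
  have "FR f (of_pos (null_measure square_borel)) (of_pos (null_measure square_borel)) \<le>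
    (\<integral>\<^sup>+ z. FR_integrand (signed_RN (null_measure square_borel) (of_pos (null_measure square_borel)) z)
      (signed_RN (null_measure square_borel) (of_pos (null_measure square_borel)) z) * ennreal (f z) \<partial>null_measure square_borel)"
    unfolding FR_def
    by (rule INF_lower) (simp add: pos_measure_null dominates_def of_pos_def absolutely_continuous_def)
  then show ?thesis by simp
qed

lemma time_derivative_null:
  "time_derivative (null_measure square_borel) (of_pos (null_measure square_borel))"
  by (simp add: time_derivative_def signed_measure_def of_pos_def pos_measure_null signed_integral_def)

lemma disintegration_null:
  "disintegration (null_measure square_borel) (\<lambda>_. null_measure (restrict_space borel {0..1}))"
  by (auto simp: disintegration_def intro!: finite_measureI)

lemma pi_star_U_meas_null: "pi_star q (U_meas (null_measure N) q) x = 0"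
  by (simp add: pi_star_def U_meas_def set_lebesgue_integral_def inner_eta_def H2_corr_vector)

text \<open>\<open>m / 4\<close> is the gain per unit of mass from \<open>FR_ge_measure\<close>, and
  the left side of the assumption on \<open>e\<close> is the largest loss per unit of mass from the
  cross term. The terminal cost is the same on both sides.\<close>

lemma energy_null_le_energy:
  assumes q: "\<And>t. t \<in> {0..1} \<Longrightarrow> q t \<in> L2"
    and bounds: "\<And>t x. t \<in> {0..1} \<Longrightarrow> x \<in> {0..1} \<Longrightarrow> m \<le> eta (q t) x \<and> eta (q t) x \<le> M"
    and mM: "0 \<le> m" "1 \<le> M"
    and acc: "\<And>t. t \<in> {0..1} \<Longrightarrow> cov_deriv_flat p q t \<in> L2 \<and> L2_norm (cov_deriv_flat p q t) \<le> e"
    and e: "2 * (M * ((1 + H2_inv_norm) * M ^ 4) * e) \<le> m / 4"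
    and \<Delta>: "\<Delta> \<in> M0"
  shows "energy P (null_measure square_borel) p q \<le> energy P \<Delta> p q"
proof -
  define J where "J = (\<integral>\<^sup>+ t. ennreal (norm_sq_at (q t) (cov_deriv_flat p q t)) \<partial>unit_leb)"
  define S where "S \<Delta> = {(\<delta>, K). time_derivative \<Delta> \<delta> \<and> disintegration \<Delta> K}" for \<Delta>
  define T where "T \<Delta> = (\<lambda>(\<delta>, K). FR (\<lambda>(t, x). eta (q t) x) (of_pos \<Delta>) \<delta> +
       (\<integral>\<^sup>+ t. ennreal (norm_sq_at (q t)
          (\<lambda>x. cov_deriv_flat p q t x + pi_star (q t) (U_meas (K t) (q t)) x)) \<partial>unit_leb))" for \<Delta>
  \<comment> \<open>At the zero measure an upper bound suffices: the zero derivative and zero slices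
    give the value \<open>J\<close>.\<close>
  have "(INF z \<in> S (null_measure square_borel). T (null_measure square_borel) z) \<le>
    T (null_measure square_borel) (of_pos (null_measure square_borel), \<lambda>_. null_measure (restrict_space borel {0..1}))"
    by (rule INF_lower) (simp add: S_def time_derivative_null disintegration_null)
  also have "\<dots> = J"
    by (simp add: T_def J_def FR_null pi_star_U_meas_null)
  also have "J \<le> (INF z \<in> S \<Delta>. T \<Delta> z)"
  proof (rule INF_greatest)
    fix z assume "z \<in> S \<Delta>"
    then obtain \<delta> K where z: "z = (\<delta>, K)" and td: "time_derivative \<Delta> \<delta>" and dis: "disintegration \<Delta> K"
      by (auto simp: S_def)
    have K: "finite_measure (K t)" "sets (K t) = sets (restrict_space borel {0..1})" if "t \<in> {0..1}" for t
      using dis that by (auto simp: disintegration_def)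
    have pm: "pos_measure \<Delta>" using \<Delta> by (simp add: M0_def)
    then have fin: "finite_measure \<Delta>" by (simp add: pos_measure_def)
    have sq: "unit_square \<in> sets square_borel"
      using sets.top[of square_borel] by (simp add: space_restrict_space)
    have slice: "{x. (t, x) \<in> unit_square} = {0..1}" if "t \<in> {0..1}" for t
      using that by auto
    have K_meas: "(\<lambda>t. emeasure (K t) {0..1}) \<in> borel_measurable unit_leb"
      and K_int: "emeasure \<Delta> unit_square = (\<integral>\<^sup>+ t. emeasure (K t) {0..1} \<partial>unit_leb)"
    proof -
      have *: "(\<lambda>t. emeasure (K t) {x. (t, x) \<in> unit_square}) \<in> borel_measurable unit_leb"
        "emeasure \<Delta> unit_square = (\<integral>\<^sup>+ t. emeasure (K t) {x. (t, x) \<in> unit_square} \<partial>unit_leb)"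
        using dis sq unfolding disintegration_def by blast+
      show "(\<lambda>t. emeasure (K t) {0..1}) \<in> borel_measurable unit_leb"
        using *(1) by (rule measurable_cong[THEN iffD1, rotated]) (simp only: space_lebesgue_on slice)
      show "emeasure \<Delta> unit_square = (\<integral>\<^sup>+ t. emeasure (K t) {0..1} \<partial>unit_leb)"
        unfolding *(2) by (rule nn_integral_cong) (simp only: space_lebesgue_on slice)
    qed
    let ?E = "\<lambda>t. norm_sq_at (q t) (\<lambda>x. cov_deriv_flat p q t x + pi_star (q t) (U_meas (K t) (q t)) x)"
    have "J \<le> (\<integral>\<^sup>+ t. ennreal (?E t) + ennreal (m / 4) * emeasure (K t) {0..1} \<partial>unit_leb)"
      unfolding J_def
    proof (rule nn_integral_mono)
      fix t assume "t \<in> space unit_leb"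
      then have t: "t \<in> {0..1}" by simp
      define \<kappa> where "\<kappa> = measure (K t) {0..1}"
      have eM: "eta (q t) x \<le> M" if "x \<in> {0..1}" for x using bounds[OF t that] by simp
      have B: "pi_star (q t) (U_meas (K t) (q t)) \<in> borel_measurable unit_leb"
        "\<And>x. x \<in> {0..1} \<Longrightarrow> \<bar>pi_star (q t) (U_meas (K t) (q t)) x\<bar>
           \<le> (1 + H2_inv_norm) * M ^ 4 * measure (K t) {0..1}"
        using pi_star_U_meas_bounds[OF q[OF t] mM(2) _ K[OF t]] eM by blast+
      have N0: "0 \<le> H2_inv_norm" by (simp add: H2_inv_norm_def)
      have "norm_sq_at (q t) (cov_deriv_flat p q t) \<le> ?E t
        + 2 * (M * ((1 + H2_inv_norm) * M ^ 4 * measure (K t) {0..1}) * L2_norm (cov_deriv_flat p q t))"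
        by (rule norm_sq_at_perturb[OF q[OF t] eM acc[OF t, THEN conjunct1] B])
      also have "\<dots> \<le> ?E t + 2 * (M * ((1 + H2_inv_norm) * M ^ 4 * \<kappa>) * e)"
        using N0 mM acc[OF t] unfolding \<kappa>_def by (intro add_left_mono mult_left_mono) auto
      also have "\<dots> = ?E t + 2 * (M * ((1 + H2_inv_norm) * M ^ 4) * e) * \<kappa>"
        by (simp add: algebra_simps)
      also have "\<dots> \<le> ?E t + m / 4 * \<kappa>"
        using e by (intro add_left_mono mult_right_mono) (auto simp: \<kappa>_def)
      finally have "ennreal (norm_sq_at (q t) (cov_deriv_flat p q t)) \<le> ennreal (?E t + m / 4 * \<kappa>)"
        by (rule ennreal_leI)
      also have "\<dots> = ennreal (?E t) + ennreal (m / 4 * \<kappa>)"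
        using mM(1) by (intro ennreal_plus norm_sq_at_nonneg) (simp add: \<kappa>_def)
      also have "ennreal (m / 4 * \<kappa>) = ennreal (m / 4) * emeasure (K t) {0..1}"
        unfolding \<kappa>_def finite_measure.emeasure_eq_measure[OF K(1)[OF t]]
        using mM(1) by (intro ennreal_mult) auto
      finally show "ennreal (norm_sq_at (q t) (cov_deriv_flat p q t))
        \<le> ennreal (?E t) + ennreal (m / 4) * emeasure (K t) {0..1}" .
    qed
    \<comment> \<open>Only the mass of the slices is known to be measurable in time, by
      \<open>disintegration\<close>; hence the one-sided splitting of the integral.\<close>
    also have "\<dots> \<le> (\<integral>\<^sup>+ t. ennreal (?E t) \<partial>unit_leb) + (\<integral>\<^sup>+ t. ennreal (m / 4) * emeasure (K t) {0..1} \<partial>unit_leb)"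
      using K_meas K(1)
      by (intro nn_integral_add_le) (auto simp: ennreal_mult_eq_top_iff finite_measure.emeasure_finite)
    also have "(\<integral>\<^sup>+ t. ennreal (m / 4) * emeasure (K t) {0..1} \<partial>unit_leb) = ennreal (m / 4) * emeasure \<Delta> unit_square"
      unfolding K_int using K_meas by (rule nn_integral_cmult)
    also have "\<dots> = ennreal (m / 4 * measure \<Delta> unit_square)"
      unfolding finite_measure.emeasure_eq_measure[OF fin]
      using mM(1) by (intro ennreal_mult[symmetric]) auto
    also have "\<dots> \<le> FR (\<lambda>(t, x). eta (q t) x) (of_pos \<Delta>) \<delta>"
      using bounds by (intro FR_ge_measure[OF pm td mM(1)]) auto
    finally show "J \<le> T \<Delta> z"
      by (simp add: z T_def add.commute)
  qed
  finally have "enn2ereal (INF z \<in> S (null_measure square_borel). T (null_measure square_borel) z) \<le>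
    enn2ereal (INF z \<in> S \<Delta>. T \<Delta> z)" by (simp add: less_eq_ennreal.rep_eq)
  then show ?thesis
    unfolding energy_def S_def[symmetric] T_def[symmetric] by (rule add_right_mono)
qed


section \<open>Neighbourhoods of geodesics\<close>

lemma L2_continuous_imp_L2_limit:
  assumes "L2_continuous u" "t \<in> {0..1}"
  shows "L2_limit u (u t) (at t within {0..1})"
proof -
  have "\<forall>\<^sub>F s in at t within {0..1}. u s \<in> L2"
    using eventually_within_unit[of t] by eventually_elim (use assms in \<open>auto simp: L2_continuous_def\<close>)
  then show ?thesis using assms by (auto simp: L2_continuous_def L2_limit_def)
qed

lemma L2_continuousI:
  assumes "\<And>t. t \<in> {0..1} \<Longrightarrow> has_L2_deriv u (w t) t"
  shows "L2_continuous u"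
proof -
  have "\<forall>t\<in>{0..1}. u t \<in> L2" using assms by (auto simp: has_L2_deriv_def)
  then show ?thesis
    using has_L2_deriv_imp_L2_limit[OF assms] by (auto simp: L2_continuous_def L2_limit_def)
qed

text \<open>A supremum of reals bounds its members only when the set is bounded above; continuity on
  the compact time interval provides this.\<close>

lemma L2_norm_le_SUP:
  assumes "L2_continuous u" "t \<in> {0..1}"
  shows "L2_norm (u t) \<le> (SUP s\<in>{0..1}. L2_norm (u s))"
proof -
  have "continuous_on {0..1} (\<lambda>s. L2_norm (u s))"
    unfolding continuous_on_def using L2_limit_norm[OF L2_continuous_imp_L2_limit[OF assms(1)]] by blast
  then have "compact ((\<lambda>s. L2_norm (u s)) ` {0..1})"
    by (rule compact_continuous_image) simp
  then have "bdd_above ((\<lambda>s. L2_norm (u s)) ` {0..1})"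
    by (intro bounded_imp_bdd_above compact_imp_bounded)
  with assms(2) show ?thesis by (rule cSUP_upper)
qed

lemma C2_curveD:
  assumes "C2_curve q" "t \<in> {0..1}"
  shows "has_L2_deriv q (L2_deriv q t) t"
    and "has_L2_deriv (L2_deriv q) (L2_deriv (L2_deriv q) t) t"
  using assms by (auto simp: C2_curve_def)

lemma C2_curve_L2_continuous:
  assumes "C2_curve q"
  shows "L2_continuous q" "L2_continuous (L2_deriv q)" "L2_continuous (L2_deriv (L2_deriv q))"
  using L2_continuousI[OF C2_curveD(1)[OF assms]] L2_continuousI[OF C2_curveD(2)[OF assms]] assms
  by (auto simp: C2_curve_def)

lemma has_L2_deriv_diff:
  assumes "has_L2_deriv u v t" "has_L2_deriv u' v' t" "t \<in> {0..1}"
  shows "has_L2_deriv (\<lambda>s x. u s x - u' s x) (\<lambda>x. v x - v' x) t"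
proof -
  have "L2_limit (\<lambda>s x. (u s x - u t x) / (s - t) - (u' s x - u' t x) / (s - t)) (\<lambda>x. v x - v' x)
    (at t within {0..1})"
    using assms by (intro L2_limit_diff) (auto simp: has_L2_deriv_iff_L2_limit)
  moreover have "(u s x - u t x) / (s - t) - (u' s x - u' t x) / (s - t) =
      (u s x - u' s x - (u t x - u' t x)) / (s - t)" for s x
    by (simp add: diff_divide_distrib)
  ultimately show ?thesis
    using assms by (simp add: has_L2_deriv_iff_L2_limit L2_diff)
qed

lemma L2_continuous_cong_AE:
  assumes "L2_continuous u" "\<And>t. t \<in> {0..1} \<Longrightarrow> u' t \<in> L2 \<and> (AE x in unit_leb. u' t x = u t x)"
  shows "L2_continuous u'"
proof -
  have "((\<lambda>s. L2_norm (\<lambda>x. u' s x - u' t x)) \<longlongrightarrow> 0) (at t within {0..1})" if t: "t \<in> {0..1}" for t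
  proof -
    have "\<forall>\<^sub>F s in at t within {0..1}. L2_norm (\<lambda>x. u s x - u t x) = L2_norm (\<lambda>x. u' s x - u' t x)"
      using eventually_within_unit[of t]
    proof eventually_elim
      case (elim s)
      have "AE x in unit_leb. u' s x = u s x" "AE x in unit_leb. u' t x = u t x"
        using assms(2) elim t by auto
      then have "AE x in unit_leb. u s x - u t x = u' s x - u' t x" by eventually_elim simp
      then show ?case
        using assms elim t by (intro L2_norm_cong_AE L2_diff) (auto simp: L2_continuous_def)
    qed
    then show ?thesis
      using assms(1) t by (auto simp: L2_continuous_def intro: tendsto_cong[THEN iffD1])
  qed
  then show ?thesis using assms by (auto simp: L2_continuous_def)
qed

lemma L2_continuous_diff:
  assumes "L2_continuous u" "L2_continuous u'"
  shows "L2_continuous (\<lambda>t x. u t x - u' t x)"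
proof -
  have "L2_limit (\<lambda>s x. u s x - u' s x) (\<lambda>x. u t x - u' t x) (at t within {0..1})" if "t \<in> {0..1}" for t
    using assms that by (intro L2_limit_diff L2_continuous_imp_L2_limit)
  then show ?thesis
    using assms by (auto simp: L2_continuous_def L2_limit_def intro: L2_diff)
qed

text \<open>\<open>L2_deriv\<close> of the difference is a choice of its own, related to the
  difference of the derivatives only almost everywhere. The second derivative inherits this through
  \<open>has_L2_deriv_cong_AE\<close>. Each of the three suprema is at most their sum, as the others
  are nonnegative.\<close>

lemma C2_norm_diff_bounds:
  assumes q: "C2_curve q" and r: "C2_curve r" and t: "t \<in> {0..1}"
  defines "d \<equiv> \<lambda>t x. q t x - r t x"
  shows "L2_norm (\<lambda>x. q t x - r t x) \<le> C2_norm d"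
    and "L2_norm (\<lambda>x. L2_deriv q t x - L2_deriv r t x) \<le> C2_norm d"
    and "L2_norm (\<lambda>x. L2_deriv (L2_deriv q) t x - L2_deriv (L2_deriv r) t x) \<le> C2_norm d"
proof -
  let ?v = "\<lambda>t x. L2_deriv q t x - L2_deriv r t x"
  let ?a = "\<lambda>t x. L2_deriv (L2_deriv q) t x - L2_deriv (L2_deriv r) t x"
  have d1: "has_L2_deriv d (?v s) s" if "s \<in> {0..1}" for s
    unfolding d_def using that by (intro has_L2_deriv_diff C2_curveD q r)
  have v: "L2_deriv d s \<in> L2 \<and> (AE x in unit_leb. L2_deriv d s x = ?v s x)" if "s \<in> {0..1}" for s
    using has_L2_deriv_L2_deriv[OF d1[OF that]] has_L2_deriv_unique[OF _ d1[OF that] that]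
    by (auto simp: has_L2_deriv_def)
  have d2: "has_L2_deriv (L2_deriv d) (?a s) s" if "s \<in> {0..1}" for s
    by (rule has_L2_deriv_cong_AE[OF has_L2_deriv_diff[OF C2_curveD(2)[OF q that] C2_curveD(2)[OF r that] that] that v])
  have a: "L2_deriv (L2_deriv d) s \<in> L2 \<and> (AE x in unit_leb. L2_deriv (L2_deriv d) s x = ?a s x)"
    if "s \<in> {0..1}" for s
    using has_L2_deriv_L2_deriv[OF d2[OF that]] has_L2_deriv_unique[OF _ d2[OF that] that]
    by (auto simp: has_L2_deriv_def)
  have c: "L2_continuous d" "L2_continuous (L2_deriv d)" "L2_continuous (L2_deriv (L2_deriv d))"
    using L2_continuousI[OF d1] L2_continuousI[OF d2]
      L2_continuous_cong_AE[OF L2_continuous_diff[OF C2_curve_L2_continuous(3)[OF q] C2_curve_L2_continuous(3)[OF r]] a]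
    by auto
  have L: "?v t \<in> L2" "?a t \<in> L2" using d1[OF t] d2[OF t] by (auto simp: has_L2_deriv_def)
  have eq: "L2_norm (?v t) = L2_norm (L2_deriv d t)" "L2_norm (?a t) = L2_norm (L2_deriv (L2_deriv d) t)"
    using v[OF t] a[OF t] L by (auto intro: L2_norm_cong_AE[symmetric])
  note le = L2_norm_le_SUP[OF c(1) t] L2_norm_le_SUP[OF c(2) t] L2_norm_le_SUP[OF c(3) t]
  note nonneg = L2_norm_nonneg[of "d t"] L2_norm_nonneg[of "L2_deriv d t"] L2_norm_nonneg[of "L2_deriv (L2_deriv d) t"]
  have "L2_norm (d t) \<le> C2_norm d" "L2_norm (L2_deriv d t) \<le> C2_norm d" "L2_norm (L2_deriv (L2_deriv d) t) \<le> C2_norm d"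
    using le nonneg unfolding C2_norm_def by linarith+
  then show "L2_norm (\<lambda>x. q t x - r t x) \<le> C2_norm d" "L2_norm (?v t) \<le> C2_norm d" "L2_norm (?a t) \<le> C2_norm d"
    by (simp_all add: eq d_def)
qed

lemma L2_limit_along_curve:
  assumes u: "L2_continuous u" and s: "\<And>n. s n \<in> {0..1}" "s \<longlonglongrightarrow> l" and l: "l \<in> {0..1}"
    and w: "\<And>n. w n \<in> L2" "(\<lambda>n. L2_norm (\<lambda>x. w n x - u (s n) x)) \<longlonglongrightarrow> 0"
  shows "L2_limit w (u l) sequentially"
proof (rule L2_limit_norm_bound)
  have uL: "u t \<in> L2" if "t \<in> {0..1}" for t using u that by (auto simp: L2_continuous_def)
  show "u l \<in> L2" using uL l by simp
  let ?g = "\<lambda>t. L2_norm (\<lambda>x. u t x - u l x)"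
  have "(?g \<longlongrightarrow> ?g l) (at l within {0..1})" using u l by (simp add: L2_continuous_def)
  then have cont: "continuous (at l within {0..1}) ?g" by (simp add: continuous_within)
  have "(\<lambda>n. ?g (s n)) \<longlonglongrightarrow> ?g l"
    by (rule continuous_within_tendsto_compose'[OF cont s])
  then show "(\<lambda>n. L2_norm (\<lambda>x. w n x - u (s n) x) + ?g (s n)) \<longlonglongrightarrow> 0"
    using tendsto_add[OF w(2)] by fastforce
  show "\<forall>\<^sub>F n in sequentially. w n \<in> L2 \<and>
    L2_norm (\<lambda>x. w n x - u l x) \<le> L2_norm (\<lambda>x. w n x - u (s n) x) + ?g (s n)"
  proof (intro always_eventually allI conjI w)
    fix n
    show "L2_norm (\<lambda>x. w n x - u l x) \<le> L2_norm (\<lambda>x. w n x - u (s n) x) + ?g (s n)"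
      using L2_norm_triangle[OF L2_diff[OF w(1) uL[OF s(1)]] L2_diff[OF uL[OF s(1)] uL[OF l]], of n n n]
      by simp
  qed
qed

text \<open>Continuity of the acceleration at each time becomes uniform in time by compactness of $[0,1]$.\<close>

lemma cov_acc_small_near_geodesic:
  assumes c: "L2_continuous q" "L2_continuous v" "L2_continuous a"
    and zero: "\<And>t. t \<in> {0..1} \<Longrightarrow> L2_norm (cov_acc (q t) (v t) (a t)) = 0"
    and e: "0 < e"
  shows "\<exists>d>0. \<forall>t\<in>{0..1}. \<forall>q'\<in>L2. \<forall>v'\<in>L2. \<forall>a'\<in>L2.
    L2_norm (\<lambda>x. q' x - q t x) < d \<longrightarrow> L2_norm (\<lambda>x. v' x - v t x) < d \<longrightarrow>
    L2_norm (\<lambda>x. a' x - a t x) < d \<longrightarrow> L2_norm (cov_acc q' v' a') < e"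
proof (rule ccontr)
  assume "\<not> ?thesis"
  then have bad: "\<exists>t q' v' a'. t \<in> {0..1} \<and> q' \<in> L2 \<and> v' \<in> L2 \<and> a' \<in> L2 \<and>
      L2_norm (\<lambda>x. q' x - q t x) < d \<and> L2_norm (\<lambda>x. v' x - v t x) < d \<and>
      L2_norm (\<lambda>x. a' x - a t x) < d \<and> \<not> L2_norm (cov_acc q' v' a') < e" if "0 < d" for d
    using that by blast
  \<comment> \<open>Radii tending to zero give a sequence of counterexamples at times
    \<open>t n\<close>.\<close>
  have "\<forall>n::nat. \<exists>t q' v' a'. t \<in> {0..1} \<and> q' \<in> L2 \<and> v' \<in> L2 \<and> a' \<in> L2 \<and>
      L2_norm (\<lambda>x. q' x - q t x) < inverse (real (Suc n)) \<and> L2_norm (\<lambda>x. v' x - v t x) < inverse (real (Suc n)) \<and>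
      L2_norm (\<lambda>x. a' x - a t x) < inverse (real (Suc n)) \<and> \<not> L2_norm (cov_acc q' v' a') < e"
    by (intro allI bad) simp
  then obtain t q' v' a' where t: "\<And>n::nat. t n \<in> {0..1}"
    and L: "\<And>n. q' n \<in> L2" "\<And>n. v' n \<in> L2" "\<And>n. a' n \<in> L2"
    and b: "\<And>n. L2_norm (\<lambda>x. q' n x - q (t n) x) < inverse (real (Suc n))"
      "\<And>n. L2_norm (\<lambda>x. v' n x - v (t n) x) < inverse (real (Suc n))"
      "\<And>n. L2_norm (\<lambda>x. a' n x - a (t n) x) < inverse (real (Suc n))"
    and ge: "\<And>n. e \<le> L2_norm (cov_acc (q' n) (v' n) (a' n))"
    unfolding choice_iff not_less by blast
  \<comment> \<open>Along a subsequence the times converge to \<open>l\<close>, so by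
    \<open>L2_limit_along_curve\<close> the three perturbed functions converge to the data of the
    geodesic at \<open>l\<close>.\<close>
  obtain l r where l: "l \<in> {0..1}" and r: "strict_mono r" "(t \<circ> r) \<longlonglongrightarrow> l"
    using t compact_Icc[of "0::real" 1] unfolding compact_def by metis
  have conv: "(\<lambda>n. L2_norm (\<lambda>x. w (r n) x - u ((t \<circ> r) n) x)) \<longlonglongrightarrow> 0"
    if "\<And>n. L2_norm (\<lambda>x. w n x - u (t n) x) < inverse (real (Suc n))" for w u
  proof -
    have "(\<lambda>n. L2_norm (\<lambda>x. w n x - u (t n) x)) \<longlonglongrightarrow> 0"
      by (rule tendsto_sandwich[OF _ _ tendsto_const LIMSEQ_inverse_real_of_nat])
        (use that in \<open>auto intro!: always_eventually less_imp_le\<close>)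
    from LIMSEQ_subseq_LIMSEQ[OF this r(1)] show ?thesis by (simp add: o_def)
  qed
  have lim: "L2_limit (\<lambda>n. w (r n)) (u l) sequentially"
    if "L2_continuous u" "\<And>n. w n \<in> L2" "\<And>n. L2_norm (\<lambda>x. w n x - u (t n) x) < inverse (real (Suc n))" for w u
    using that(2) t by (intro L2_limit_along_curve[OF that(1) _ r(2) l _ conv[OF that(3)]]) auto
  have "(\<lambda>n. L2_norm (cov_acc (q' (r n)) (v' (r n)) (a' (r n)))) \<longlonglongrightarrow> L2_norm (cov_acc (q l) (v l) (a l))"
    by (intro L2_limit_norm L2_limit_cov_acc lim c L b)
  then have "e \<le> L2_norm (cov_acc (q l) (v l) (a l))"
    using ge by (intro LIMSEQ_le_const) auto
  then show False using zero[OF l] e by simp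
qed

section \<open>The acceleration of geodesics and of admissible paths\<close>

lemma velocity_flat_in_L2:
  assumes "q t \<in> L2" "L2_deriv q t \<in> L2"
  shows "velocity_flat q t \<in> L2"
  using L2_limit_mult[OF unif_limit_inverse_eta[OF L2_limit_const[OF assms(1)]] L2_limit_const[OF assms(2)],
      where F=sequentially]
  by (simp add: L2_limit_def velocity_flat_def[abs_def])

lemma geodesic_cov_acc_zero:
  assumes "geodesic q" "t \<in> {0..1}"
  shows "L2_norm (cov_acc (q t) (L2_deriv q t) (L2_deriv (L2_deriv q) t)) = 0"
proof -
  have Q: "q s \<in> Q_mfd" if "s \<in> {0..1}" for s using assms that by (auto simp: geodesic_def)
  have C2: "C2_curve q" using assms by (auto simp: geodesic_def)
  note d = C2_curveD[OF C2 assms(2)]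
  have L: "q s \<in> L2" "L2_deriv q s \<in> L2" if "s \<in> {0..1}" for s
    using C2_curveD[OF C2 that] that by (auto simp: has_L2_deriv_def)
  have "AE x in unit_leb. cov_deriv_flat (velocity_flat q) q t x
      = cov_acc (q t) (L2_deriv q t) (L2_deriv (L2_deriv q) t) x"
    by (rule cov_deriv_flat_AE(2)[OF d assms(2) _ Q[OF assms(2)]])
      (use L velocity_flat_in_L2 in \<open>auto simp: velocity_flat_def\<close>)
  moreover have "AE x in unit_leb. cov_deriv_flat (velocity_flat q) q t x = 0"
    using assms by (auto simp: geodesic_def L2_eq_def)
  ultimately have "AE x in unit_leb. cov_acc (q t) (L2_deriv q t) (L2_deriv (L2_deriv q) t) x = 0"
    by eventually_elim simp
  moreover have "L2_deriv (L2_deriv q) t \<in> L2" using d by (auto simp: has_L2_deriv_def)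
  ultimately show ?thesis
    using L[OF assms(2)] by (intro L2_norm_zero_AE cov_acc_in_L2)
qed

text \<open>Uniqueness of strong derivatives forces \<open>p = L2_deriv q / eta q\<close> almost
  everywhere, so control of \<open>q\<close> alone determines the covector of the
  acceleration.\<close>

lemma admissible_cov_deriv_flat:
  assumes pq: "(p, q) \<in> C0_paths q0 p0" and C2: "C2_curve q" and t: "t \<in> {0..1}"
  shows "cov_deriv_flat p q t \<in> L2"
    and "L2_norm (cov_deriv_flat p q t) = L2_norm (cov_acc (q t) (L2_deriv q t) (L2_deriv (L2_deriv q) t))"
proof -
  have Q: "q s \<in> Q_mfd" "p s \<in> L2" "has_L2_deriv q (\<lambda>x. eta (q s) x * p s x) s" if "s \<in> {0..1}" for s
    using pq that by (auto simp: C0_paths_def cotangent_def)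
  have p: "p s \<in> L2 \<and> (AE x in unit_leb. p s x = L2_deriv q s x / eta (q s) x)" if s: "s \<in> {0..1}" for s
  proof -
    have "AE x in unit_leb. eta (q s) x * p s x = L2_deriv q s x"
      by (rule has_L2_deriv_unique[OF Q(3)[OF s] C2_curveD(1)[OF C2 s] s])
    then have "AE x in unit_leb. p s x = L2_deriv q s x / eta (q s) x"
      by eventually_elim (simp add: field_simps)
    then show ?thesis using Q(2)[OF s] by simp
  qed
  note A = cov_deriv_flat_AE[OF C2_curveD[OF C2 t] t p Q(1)[OF t]]
  show "cov_deriv_flat p q t \<in> L2" by (rule A(1))
  show "L2_norm (cov_deriv_flat p q t) = L2_norm (cov_acc (q t) (L2_deriv q t) (L2_deriv (L2_deriv q) t))"
    using C2_curveD[OF C2 t] t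
    by (intro L2_norm_cong_AE A cov_acc_in_L2) (auto simp: has_L2_deriv_def)
qed

theorem corollary7p12:
  fixes q0 p0 q1 p1 :: "real \<Rightarrow> real"
    and P :: "(real \<Rightarrow> real) \<Rightarrow> (real \<Rightarrow> real) \<Rightarrow> real"
    and C :: "path set"
    and p q :: "real \<Rightarrow> real \<Rightarrow> real"
  assumes "q0 \<in> Q_mfd" and "p0 \<in> cotangent q0"
    and "q1 \<in> Q_mfd" and "p1 \<in> cotangent q1"
    and "C = C0_paths q0 p0 \<or> C = C01_paths q0 p0 q1 p1"
    and "geodesic q" and "(p, q) \<in> C"
  shows "\<exists>\<epsilon>>0. C2_ball C q \<epsilon> \<subseteq> optimal_at_zero P C"
proof -
  have C0: "(p', q') \<in> C0_paths q0 p0" if "(p', q') \<in> C" for p' q'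
    using assms(5) that by (auto simp: C01_paths_def)
  have C2: "C2_curve q" using assms(6) by (simp add: geodesic_def)
  note c = C2_curve_L2_continuous[OF C2]
  \<comment> \<open>The ball has radius at most 1, so \<open>R\<close> bounds the L2 norm at each
    time for every curve in it. Hence \<open>eta\<close> lies between \<open>exp (- R)\<close> and
    \<open>exp R\<close>, the \<open>m\<close> and \<open>M\<close> of
    \<open>energy_null_le_energy\<close>.\<close>
  define R where "R = (SUP t\<in>{0..1}. L2_norm (q t)) + 1"
  have R: "L2_norm (q t) + 1 \<le> R" if "t \<in> {0..1}" for t
    using L2_norm_le_SUP[OF c(1) that] by (simp add: R_def)
  have R0: "0 \<le> R" using R[of 0] L2_norm_nonneg[of "q 0"] by (simp del: L2_norm_nonneg)
  define K where "K = 2 * (exp R * ((1 + H2_inv_norm) * exp R ^ 4))"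
  have K: "0 < K" by (auto simp: K_def H2_inv_norm_def intro!: mult_pos_pos add_pos_nonneg)
  \<comment> \<open>Chosen so that \<open>K * e = exp (- R) / 4\<close>: the worst loss from the
    cross term equals the guaranteed Fisher-Rao gain.\<close>
  define e where "e = exp (- R) / 4 / K"
  have e: "0 < e" "2 * (exp R * ((1 + H2_inv_norm) * exp R ^ 4) * e) \<le> exp (- R) / 4"
    using K by (auto simp: e_def K_def)
  obtain d where d: "d > 0" "\<And>t q' v' a'. t \<in> {0..1} \<Longrightarrow> q' \<in> L2 \<Longrightarrow> v' \<in> L2 \<Longrightarrow> a' \<in> L2 \<Longrightarrow>
      L2_norm (\<lambda>x. q' x - q t x) < d \<Longrightarrow> L2_norm (\<lambda>x. v' x - L2_deriv q t x) < d \<Longrightarrow>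
      L2_norm (\<lambda>x. a' x - L2_deriv (L2_deriv q) t x) < d \<Longrightarrow> L2_norm (cov_acc q' v' a') < e"
    using cov_acc_small_near_geodesic[OF c geodesic_cov_acc_zero[OF assms(6)] e(1)] by blast
  have "C2_ball C q (min d 1) \<subseteq> optimal_at_zero P C"
  proof
    fix z assume "z \<in> C2_ball C q (min d 1)"
    then obtain p' q' where z: "z = (p', q')" and C: "(p', q') \<in> C" and C2': "C2_curve q'"
      and less: "C2_norm (\<lambda>t x. q' t x - q t x) < min d 1"
      by (auto simp: C2_ball_def)
    note near = C2_norm_diff_bounds[OF C2' C2, THEN le_less_trans, OF _ less]
    have L: "q' t \<in> L2" "L2_deriv q' t \<in> L2" "L2_deriv (L2_deriv q') t \<in> L2" if "t \<in> {0..1}" for t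
      using C2_curveD[OF C2' that] that by (auto simp: has_L2_deriv_def)
    have qL: "q t \<in> L2" if "t \<in> {0..1}" for t using c(1) that by (simp add: L2_continuous_def)
    have "\<bar>primitive (q' t) x\<bar> \<le> R" if "t \<in> {0..1}" "x \<in> {0..1}" for t x
      using abs_primitive_le[OF L(1)[OF that(1)] that(2)] L2_norm_triangle_diff[OF L(1) qL, OF that(1) that(1)]
        near(1)[OF that(1)] R[OF that(1)] by linarith
    then have bounds: "exp (- R) \<le> eta (q' t) x \<and> eta (q' t) x \<le> exp R" if "t \<in> {0..1}" "x \<in> {0..1}" for t x
      using that by (auto simp: eta_eq_exp_primitive abs_le_iff minus_le_iff)
    have acc: "cov_deriv_flat p' q' t \<in> L2 \<and> L2_norm (cov_deriv_flat p' q' t) \<le> e" if t: "t \<in> {0..1}" for t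
      using admissible_cov_deriv_flat[OF C0[OF C] C2' t] d(2)[OF t L[OF t]] near[OF t] by auto
    have "energy P (null_measure square_borel) p' q' \<le> energy P \<Delta> p' q'" if "\<Delta> \<in> M0" for \<Delta>
      using R0 by (intro energy_null_le_energy[OF L(1) bounds _ _ acc e(2) that]) auto
    then show "z \<in> optimal_at_zero P C" using C by (simp add: z optimal_at_zero_def)
  qed
  then show ?thesis using d(1) by (intro exI[of _ "min d 1"]) auto
qed

end
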